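(* Let $p\in[1,\infty]$, let $\omega$ be a regular majorant, and let $f\in\mathscr{A}(\mathbb{D})$. Suppose that the boundary function of $|f|$ belongs to $\Lambda_{\omega,p}(\mathbb{T})$. Then the following statements are equivalent. (E1) $f\in\Lambda_{\omega,p}(\mathbb{D})$. (E2) There is a constant $M>0$ such that for all $z\in\mathbb{D}$: $\left(\int_0^{2\pi}\left(P[|f|](ze^{i\eta})-|f(ze^{i\eta})|\right)^p d\eta\right)^{1/p}\le M\omega(d_{\mathbb{D}}(z))$ if $p\in[1,\infty)$, and $P[|f|](z)-|f(z)|\le M\omega(d_{\mathbb{D}}(z))$ if $p=\infty$.
   Context: $\mathbb{D}$ is the open unit disk in $\mathbb{C}$, $\mathbb{T}=\partial\mathbb{D}$, $d_{\mathbb{D}}(z)=1-|z|$. $\mathscr{A}(\mathbb{D})$ is the disk algebra: functions analytic in $\mathbb{D}$ and continuous up to the boundary. A majorant is a continuous increasing function $\omega:[0,\infty)\to[0,\infty)$ with $\omega(0)=0$ such that $\omega(t)/t$ is non-increasing for $t>0$. It is regular if, for some $\delta_0>0$ and $M>0$, both $\int_0^\delta\frac{\omega(t)}{t}\,dt\le M\omega(\delta)$ and $\delta\int_\delta^\infty\frac{\omega(t)}{t^2}\,dt\le M\omega(\delta)$ hold for all $0<\delta<\delta_0$. For $p\in(0,\infty)$ put $\mathcal{L}_p[F](z_1,z_2)=\left(\int_0^{2\pi}|F(e^{i\eta}z_1)-F(e^{i\eta}z_2)|^p\,d\eta\right)^{1/p}$, and $\mathcal{L}_\infty[F](z_1,z_2)=|F(z_1)-F(z_2)|$.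 $\Lambda_{\omega,p}(\mathbb{T})$ consists of those $F\in L^p(\mathbb{T})$ for which there is $M>0$ with $\mathcal{L}_p[F](\xi_1,\xi_2)\le M\omega(|\xi_1-\xi_2|)$ for all $\xi_1,\xi_2\in\mathbb{T}$. $\Lambda_{\omega,p}(\mathbb{D})$ is the class of Borel functions $F:\mathbb{D}\to\mathbb{C}$ for which there is $M>0$ with $\mathcal{L}_p[F](z_1,z_2)\le M\omega(|z_1-z_2|)$ for all $z_1,z_2\in\mathbb{D}$. $P[\varphi](z)=\frac1{2\pi}\int_0^{2\pi}\varphi(e^{i\tau})\frac{1-|z|^2}{|e^{i\tau}-z|^2}\,d\tau$ is the Poisson integral, and $P[|f|]$ denotes the Poisson integral of the boundary function of $|f|$. *)

theory Defs
  imports "HOL-Analysis.Analysis" "HOL-Complex_Analysis.Complex_Analysis"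
begin

text \<open>
  Functions on the disk, the circle or the closed disk are total functions on \<^typ>\<open>complex\<close>;
  only their values on the respective set matter.  A function of the disk algebra carries its
  continuous boundary values, so its boundary function is its restriction to \<^term>\<open>sphere 0 1\<close>.
\<close>

definition disk_algebra :: "(complex \<Rightarrow> complex) set" where
  "disk_algebra = {f. f analytic_on ball 0 1 \<and> continuous_on (cball 0 1) f}"

definition dist_bdry :: "complex \<Rightarrow> real" where
  "dist_bdry z = 1 - norm z"

text \<open>Increasing is read in the weak sense, which includes strictly increasing majorants.\<close>

definition majorant :: "(real \<Rightarrow> real) \<Rightarrow> bool" where
  "majorant \<omega> \<longleftrightarrow>
     continuous_on {0..} \<omega> \<and> (\<forall>t\<ge>0. 0 \<le> \<omega> t) \<and> mono_on {0..} \<omega> \<and> \<omega> 0 = 0 \<and>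
     antimono_on {0<..} (\<lambda>t. \<omega> t / t)"

text \<open>The integrals are \<^typ>\<open>ennreal\<close>-valued, so the bounds include their convergence.\<close>

definition regular_majorant :: "(real \<Rightarrow> real) \<Rightarrow> bool" where
  "regular_majorant \<omega> \<longleftrightarrow> majorant \<omega> \<and>
     (\<exists>\<delta>\<^sub>0>0. \<exists>M>0. \<forall>\<delta>. 0 < \<delta> \<and> \<delta> < \<delta>\<^sub>0 \<longrightarrow>
        (\<integral>\<^sup>+t\<in>{0<..<\<delta>}. ennreal (\<omega> t / t) \<partial>lborel) \<le> ennreal (M * \<omega> \<delta>) \<and>
        ennreal \<delta> * (\<integral>\<^sup>+t\<in>{\<delta><..}. ennreal (\<omega> t / t\<^sup>2) \<partial>lborel) \<le> ennreal (M * \<omega> \<delta>))"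

text \<open>Real power of an extended nonnegative number, for a positive exponent.\<close>

definition ennreal_powr :: "ennreal \<Rightarrow> real \<Rightarrow> ennreal" where
  "ennreal_powr x a = (if x = \<infinity> then \<infinity> else ennreal (enn2real x powr a))"

text \<open>
  \<open>(\<integral>\<^sub>0\<^sup>2\<^sup>\<pi> h(\<eta>)\<^sup>p d\<eta>)\<^sup>1\<^sup>/\<^sup>p\<close> for nonnegative \<open>h\<close>, possibly infinite.
\<close>

definition angular_norm :: "real \<Rightarrow> (real \<Rightarrow> real) \<Rightarrow> ennreal" where
  "angular_norm p h =
     ennreal_powr (\<integral>\<^sup>+\<eta>. ennreal (h \<eta> powr p) \<partial>lebesgue_on {0..2*pi}) (1 / p)"

definition mean_osc :: "ennreal \<Rightarrow> (complex \<Rightarrow> complex) \<Rightarrow> complex \<Rightarrow> complex \<Rightarrow> ennreal" where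
  "mean_osc p F z\<^sub>1 z\<^sub>2 =
     (if p = \<infinity> then ennreal (norm (F z\<^sub>1 - F z\<^sub>2))
      else angular_norm (enn2real p) (\<lambda>\<eta>. norm (F (cis \<eta> * z\<^sub>1) - F (cis \<eta> * z\<^sub>2))))"

text \<open>The circle is parametrised by \<^const>\<open>cis\<close>; the elements are functions, not a.e.-classes.\<close>

definition Lp_circle :: "ennreal \<Rightarrow> (complex \<Rightarrow> complex) set" where
  "Lp_circle p = {F.
     (\<lambda>\<eta>. F (cis \<eta>)) \<in> borel_measurable (lebesgue_on {0..2*pi}) \<and>
     (if p = \<infinity> then \<exists>C. AE \<eta> in lebesgue_on {0..2*pi}. norm (F (cis \<eta>)) \<le> C
      else (\<integral>\<^sup>+\<eta>. ennreal (norm (F (cis \<eta>)) powr enn2real p) \<partial>lebesgue_on {0..2*pi}) < \<infinity>)}"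

definition Lipschitz_circle :: "(real \<Rightarrow> real) \<Rightarrow> ennreal \<Rightarrow> (complex \<Rightarrow> complex) set" where
  "Lipschitz_circle \<omega> p = {F \<in> Lp_circle p.
     \<exists>M>0. \<forall>\<xi>\<^sub>1\<in>sphere 0 1. \<forall>\<xi>\<^sub>2\<in>sphere 0 1.
       mean_osc p F \<xi>\<^sub>1 \<xi>\<^sub>2 \<le> ennreal (M * \<omega> (norm (\<xi>\<^sub>1 - \<xi>\<^sub>2)))}"

definition Lipschitz_disk :: "(real \<Rightarrow> real) \<Rightarrow> ennreal \<Rightarrow> (complex \<Rightarrow> complex) set" where
  "Lipschitz_disk \<omega> p = {F \<in> borel_measurable (restrict_space borel (ball 0 1)).
     \<exists>M>0. \<forall>z\<^sub>1\<in>ball 0 1. \<forall>z\<^sub>2\<in>ball 0 1.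
       mean_osc p F z\<^sub>1 z\<^sub>2 \<le> ennreal (M * \<omega> (norm (z\<^sub>1 - z\<^sub>2)))}"

definition Poisson_integral :: "(complex \<Rightarrow> real) \<Rightarrow> complex \<Rightarrow> real" where
  "Poisson_integral \<phi> z =
     1 / (2*pi) * (\<integral>\<tau>. \<phi> (cis \<tau>) * ((1 - (norm z)\<^sup>2) / (norm (cis \<tau> - z))\<^sup>2)
                      \<partial>lebesgue_on {0..2*pi})"

end

theory Submission
  imports Defs
begin

text \<open>
  Write \<open>u = P[|f|]\<close>, \<open>d(z) = 1 - |z|\<close> and let \<open>\<parallel>h\<parallel>\<close> denote the \<open>L\<^sup>p\<close> norm of a function of the
  rotation angle \<open>\<eta>\<close>.  All functions involved are continuous, so every norm is an ordinary
  integral over \<open>[0, 2\<pi>]\<close>, or a supremum if \<open>p = \<infinity>\<close>, and both cases are covered by one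
  relation \<open>\<parallel>h\<parallel> \<le> B\<close>.  Since Poisson integrals and complex derivatives commute with rotations,
  everything reduces to pointwise estimates followed by Minkowski's integral inequality
  \<open>\<parallel>\<integral> g\<^sub>s ds\<parallel> \<le> \<integral> \<parallel>g\<^sub>s\<parallel> ds\<close> (\<open>angular_le_integral\<close>).

  The condition on \<open>\<delta> \<integral> \<omega>(t)/t\<^sup>2 dt\<close> says that the Poisson average of \<open>\<omega>(|\<zeta> - z|)\<close> is
  \<open>O(\<omega>(d(z)))\<close> (\<open>Poisson_majorant\<close>).  If \<open>f\<close> is Lipschitz in the disk, it is so up to the
  boundary by continuity, and \<open>0 \<le> u(z) - |f(z)| \<le> P[|f - f(z)|](z)\<close> gives the bound on
  \<open>u - |f|\<close> (\<open>defect_le\<close>).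

  For the converse, the key inequality (\<open>deriv_le_Poisson\<close>) is
  \<open>(1 - |z|\<^sup>2) |f'(z)| \<le> 2 P[||f| - a|](z) + 2 (u(z) - |f(z)|)\<close> for every real \<open>a\<close>.  With
  \<open>a = |f(z/|z|)|\<close> the first term is controlled by the smoothness of \<open>|f|\<close> on the circle, the second
  one by the hypothesis on \<open>u - |f|\<close>, whence \<open>\<parallel>f'\<parallel> = O(\<omega>(d)/d)\<close> (\<open>deriv_angular_le\<close>).  This is
  integrated along a path that moves two points at distance \<open>h\<close> radially to depth \<open>h\<close> and then
  joins them by a segment; the radial parts converge because \<open>\<integral>\<^sub>0\<^sup>h \<omega>(t)/t dt = O(\<omega>(h))\<close>
  (\<open>osc_le\<close>).
\<close>

section \<open>Bounds for angular norms of continuous functions\<close>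

text \<open>
  The relation \<open>\<parallel>h\<parallel>\<^sub>p \<le> B\<close> on \<open>[0, 2\<pi>]\<close> for nonnegative continuous \<open>h\<close> and \<open>B \<ge> 0\<close>.  Comparing
  \<open>p\<close>-th powers avoids roots and extended real values, and for \<open>p = \<infinity>\<close> the essential supremum of a
  continuous function is a bound at every point.
\<close>

definition angular_le :: "ennreal \<Rightarrow> (real \<Rightarrow> real) \<Rightarrow> real \<Rightarrow> bool" where
  "angular_le p h B \<longleftrightarrow>
     (if p = \<infinity> then \<forall>\<eta>\<in>{0..2*pi}. h \<eta> \<le> B
      else integral {0..2*pi} (\<lambda>\<eta>. h \<eta> powr enn2real p) \<le> B powr enn2real p)"

lemma enn2real_ge_1: "1 \<le> (p::ennreal) \<Longrightarrow> p \<noteq> \<infinity> \<Longrightarrow> 1 \<le> enn2real p"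
  by (cases p) auto

lemma continuous_on_powr_const:
  fixes h :: "'a::topological_space \<Rightarrow> real"
  assumes "continuous_on S h" "\<And>x. x \<in> S \<Longrightarrow> 0 \<le> h x" "0 < q"
  shows "continuous_on S (\<lambda>x. h x powr q)"
  by (rule continuous_on_powr') (use assms in \<open>auto intro: continuous_intros\<close>)

lemma angular_norm_le_iff:
  assumes q: "1 \<le> q" and h: "continuous_on {0..2*pi} h" "\<And>\<eta>. \<eta> \<in> {0..2*pi} \<Longrightarrow> 0 \<le> h \<eta>"
    and B: "0 \<le> B"
  shows "angular_norm q h \<le> ennreal B \<longleftrightarrow> integral {0..2*pi} (\<lambda>\<eta>. h \<eta> powr q) \<le> B powr q"
proof -
  let ?I = "integral {0..2*pi} (\<lambda>\<eta>. h \<eta> powr q)"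
  have cont: "continuous_on {0..2*pi} (\<lambda>\<eta>. h \<eta> powr q)"
    using continuous_on_powr_const[OF h] q by simp
  have I0: "0 \<le> ?I"
    by (rule integral_nonneg[OF integrable_continuous_real[OF cont]]) simp
  have "(\<integral>\<^sup>+\<eta>. ennreal (h \<eta> powr q) \<partial>lebesgue_on {0..2*pi})
      = (\<integral>\<^sup>+\<eta>. ennreal (h \<eta> powr q) * indicator {0..2*pi} \<eta> \<partial>lborel)"
    by (subst nn_integral_restrict_space) (auto simp: nn_integral_completion)
  also have "\<dots> = ennreal ?I"
    by (rule nn_integral_has_integral_lebesgue')
      (auto intro: integrable_integral integrable_continuous_real[OF cont])
  finally have "angular_norm q h = ennreal (?I powr (1/q))"
    using I0 by (simp add: angular_norm_def ennreal_powr_def)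
  moreover have "?I powr (1/q) \<le> B \<longleftrightarrow> ?I \<le> B powr q"
  proof
    assume "?I powr (1/q) \<le> B"
    then have "(?I powr (1/q)) powr q \<le> B powr q" using q by (intro powr_mono2) auto
    then show "?I \<le> B powr q" using q I0 by (simp add: powr_powr)
  next
    assume "?I \<le> B powr q"
    then have "?I powr (1/q) \<le> (B powr q) powr (1/q)" using q I0 by (intro powr_mono2) auto
    then show "?I powr (1/q) \<le> B" using q B by (simp add: powr_powr)
  qed
  ultimately show ?thesis using B by (simp add: ennreal_le_iff)
qed

lemma angular_le_mono:
  assumes p: "1 \<le> p"
    and h: "continuous_on {0..2*pi} h" "continuous_on {0..2*pi} k"
      "\<And>\<eta>. \<eta> \<in> {0..2*pi} \<Longrightarrow> 0 \<le> h \<eta> \<and> h \<eta> \<le> k \<eta>"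
    and B: "0 \<le> B" "B \<le> C" and kB: "angular_le p k B"
  shows "angular_le p h C"
proof (cases "p = \<infinity>")
  case True
  then show ?thesis using kB B h(3) unfolding angular_le_def by fastforce
next
  case False
  let ?q = "enn2real p"
  have q: "1 \<le> ?q" using enn2real_ge_1[OF p False] .
  have k0: "\<And>\<eta>. \<eta> \<in> {0..2*pi} \<Longrightarrow> 0 \<le> k \<eta>" using h(3) by fastforce
  have "integral {0..2*pi} (\<lambda>\<eta>. h \<eta> powr ?q) \<le> integral {0..2*pi} (\<lambda>\<eta>. k \<eta> powr ?q)"
    by (rule integral_le)
      (use h k0 q in \<open>auto intro!: integrable_continuous_real continuous_on_powr_const powr_mono2\<close>)
  also have "\<dots> \<le> B powr ?q" using kB False by (simp add: angular_le_def)
  also have "\<dots> \<le> C powr ?q" using B q by (intro powr_mono2) auto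
  finally show ?thesis using False by (simp add: angular_le_def)
qed

lemma angular_le_cmult:
  assumes "1 \<le> p" "\<And>\<eta>. \<eta> \<in> {0..2*pi} \<Longrightarrow> 0 \<le> h \<eta>" "0 \<le> c" "0 \<le> B" "angular_le p h B"
  shows "angular_le p (\<lambda>\<eta>. c * h \<eta>) (c * B)"
proof (cases "p = \<infinity>")
  case True
  then show ?thesis using assms by (auto simp: angular_le_def intro: mult_left_mono)
next
  case False
  have "integral {0..2*pi} (\<lambda>\<eta>. (c * h \<eta>) powr enn2real p)
      = integral {0..2*pi} (\<lambda>\<eta>. c powr enn2real p * h \<eta> powr enn2real p)"
    by (rule integral_cong) (use assms in \<open>auto simp: powr_mult\<close>)
  then show ?thesis using assms False
    by (simp add: angular_le_def powr_mult mult_left_mono)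
qed

text \<open>
  The triangle inequality with the constant \<open>4\<close>, from \<open>(x + y)\<^sup>q \<le> 2\<^sup>q (x\<^sup>q + y\<^sup>q)\<close> and
  \<open>2 \<cdot> 2\<^sup>q \<le> 4\<^sup>q\<close>; only the order of magnitude of the bounds matters later.
\<close>

lemma angular_le_add:
  assumes p: "1 \<le> p"
    and h: "continuous_on {0..2*pi} h" "\<And>\<eta>. \<eta> \<in> {0..2*pi} \<Longrightarrow> 0 \<le> h \<eta>"
    and k: "continuous_on {0..2*pi} k" "\<And>\<eta>. \<eta> \<in> {0..2*pi} \<Longrightarrow> 0 \<le> k \<eta>"
    and B: "0 \<le> B" and hB: "angular_le p h B" and kB: "angular_le p k B"
  shows "angular_le p (\<lambda>\<eta>. h \<eta> + k \<eta>) (4 * B)"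
proof (cases "p = \<infinity>")
  case True
  then show ?thesis using hB kB B unfolding angular_le_def by fastforce
next
  case False
  let ?q = "enn2real p"
  have q: "1 \<le> ?q" using enn2real_ge_1[OF p False] .
  have cont: "continuous_on {0..2*pi} (\<lambda>\<eta>. h \<eta> powr ?q)" "continuous_on {0..2*pi} (\<lambda>\<eta>. k \<eta> powr ?q)"
    "continuous_on {0..2*pi} (\<lambda>\<eta>. (h \<eta> + k \<eta>) powr ?q)"
    by (rule continuous_on_powr_const; use q h k in \<open>auto intro!: continuous_on_add\<close>)+
  have pw: "(x + y) powr ?q \<le> 2 powr ?q * (x powr ?q + y powr ?q)" if "0 \<le> x" "0 \<le> y" for x y :: real
  proof -
    have "(x + y) powr ?q \<le> (2 * max x y) powr ?q" using that q by (intro powr_mono2) auto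
    also have "\<dots> = 2 powr ?q * max x y powr ?q" using that by (simp add: powr_mult)
    also have "\<dots> \<le> 2 powr ?q * (x powr ?q + y powr ?q)" by (simp add: max_def)
    finally show ?thesis .
  qed
  have "integral {0..2*pi} (\<lambda>\<eta>. (h \<eta> + k \<eta>) powr ?q)
      \<le> integral {0..2*pi} (\<lambda>\<eta>. 2 powr ?q * (h \<eta> powr ?q + k \<eta> powr ?q))"
    by (rule integral_le)
      (use cont h k pw in \<open>auto intro!: integrable_continuous_real continuous_intros\<close>)
  also have "\<dots> = 2 powr ?q * (integral {0..2*pi} (\<lambda>\<eta>. h \<eta> powr ?q) + integral {0..2*pi} (\<lambda>\<eta>. k \<eta> powr ?q))"
    using cont by (simp add: integral_add integrable_continuous_real)
  also have "\<dots> \<le> 2 powr ?q * (B powr ?q + B powr ?q)"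
    using hB kB False by (intro mult_left_mono add_mono) (auto simp: angular_le_def)
  also have "\<dots> = 2 powr ?q * (2 * B powr ?q)" by simp
  also have "\<dots> \<le> 2 powr ?q * (2 powr ?q * B powr ?q)"
    using powr_mono[of 1 ?q 2] q by (intro mult_left_mono mult_right_mono) auto
  also have "\<dots> = (4 * B) powr ?q" using B powr_mult[of 2 2 ?q] by (simp add: powr_mult)
  finally show ?thesis using False by (simp add: angular_le_def)
qed

lemma continuous_on_slice:
  assumes "continuous_on (A \<times> B) (\<lambda>(s, \<eta>). g s \<eta>)" "\<eta> \<in> B"
  shows "continuous_on A (\<lambda>s. g s \<eta>)"
proof -
  have "continuous_on A ((\<lambda>(s, \<eta>). g s \<eta>) \<circ> (\<lambda>s. (s, \<eta>)))"
    by (intro continuous_on_compose continuous_on_subset[OF assms(1)])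
      (use assms(2) in \<open>auto intro!: continuous_intros\<close>)
  then show ?thesis by (simp add: o_def)
qed

lemma continuous_on_integral_parameter:
  fixes g :: "real \<Rightarrow> 'a::topological_space \<Rightarrow> real"
  assumes "continuous_on ({a..b} \<times> B) (\<lambda>(s, \<eta>). g s \<eta>)"
  shows "continuous_on B (\<lambda>\<eta>. integral {a..b} (\<lambda>s. g s \<eta>))"
proof -
  have "continuous_on (B \<times> {a..b}) ((\<lambda>(s, \<eta>). g s \<eta>) \<circ> (\<lambda>(\<eta>, s). (s, \<eta>)))"
    by (intro continuous_on_compose continuous_on_subset[OF assms])
      (auto intro!: continuous_intros simp: case_prod_unfold)
  then have "continuous_on (B \<times> cbox a b) (\<lambda>(\<eta>, s). g s \<eta>)"
    by (simp add: o_def case_prod_unfold)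
  from integral_continuous_on_param[OF this] show ?thesis by simp
qed

text \<open>
  Both sides of the bound are continuous in the parameter, so it passes to the end of the interval.
  This extends estimates from the open disk to the circle.
\<close>

lemma angular_le_limit:
  assumes p: "1 \<le> p"
    and h: "continuous_on ({0..1} \<times> {0..2*pi}) (\<lambda>(r, \<eta>). h r \<eta>)"
      "\<And>r \<eta>. r \<in> {0..1} \<Longrightarrow> \<eta> \<in> {0..2*pi} \<Longrightarrow> 0 \<le> h r \<eta>"
    and B: "continuous_on {0..1} B" "\<And>r. r \<in> {0..1::real} \<Longrightarrow> 0 \<le> B r"
    and le: "\<And>r. 0 \<le> r \<Longrightarrow> r < 1 \<Longrightarrow> angular_le p (h r) (B r)"
  shows "angular_le p (h 1) (B 1)"
proof -
  have closed: "u 1 \<le> v 1"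
    if "continuous_on {0..1} u" "continuous_on {0..1} v" "\<And>r. 0 \<le> r \<Longrightarrow> r < 1 \<Longrightarrow> u r \<le> v r"
    for u v :: "real \<Rightarrow> real"
  proof (rule tendsto_le)
    show "at_left (1::real) \<noteq> bot" by simp
    have eq: "at (1::real) within {0..1} = at_left 1"
      by (simp add: at_within_Icc_at_left)
    show "(u \<longlongrightarrow> u 1) (at_left 1)" "(v \<longlongrightarrow> v 1) (at_left 1)"
      using that(1,2) unfolding continuous_on_def eq[symmetric] by auto
    show "\<forall>\<^sub>F r in at_left 1. u r \<le> v r"
      by (rule eventually_mono[OF eventually_at_left_real[of 0 "1::real"]]) (use that(3) in auto)
  qed
  show ?thesis
  proof (cases "p = \<infinity>")
    case True
    have "h 1 \<eta> \<le> B 1" if \<eta>: "\<eta> \<in> {0..2*pi}" for \<eta>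
      by (rule closed[of "\<lambda>r. h r \<eta>", OF continuous_on_slice[OF h(1) \<eta>] B(1)])
        (use le True \<eta> in \<open>auto simp: angular_le_def\<close>)
    then show ?thesis using True by (simp add: angular_le_def)
  next
    case False
    let ?q = "enn2real p"
    have q: "1 \<le> ?q" using enn2real_ge_1[OF p False] .
    have "continuous_on ({0..1} \<times> {0..2*pi}) (\<lambda>x. (case x of (r, \<eta>) \<Rightarrow> h r \<eta>) powr ?q)"
      by (rule continuous_on_powr_const) (use h q in auto)
    then have c1: "continuous_on {0..1} (\<lambda>r. integral (cbox 0 (2*pi)) (\<lambda>\<eta>. h r \<eta> powr ?q))"
      by (intro integral_continuous_on_param) (simp add: case_prod_unfold)
    have c2: "continuous_on {0..1} (\<lambda>r. B r powr ?q)"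
      by (rule continuous_on_powr_const) (use B q in auto)
    show ?thesis
      using closed[OF c1 c2] le False by (simp add: angular_le_def)
  qed
qed

text \<open>
  The graph of the convex function \<open>t\<^sup>q\<close> lies above its tangent at \<open>c\<close>; after dividing by \<open>c\<^sup>q\<close>
  this is Young's inequality for \<open>(t/c)\<^sup>q\<close> and \<open>1\<close>.
\<close>

lemma powr_ge_tangent:
  fixes t c q :: real
  assumes "1 \<le> q" "0 \<le> t" "0 \<le> c"
  shows "c powr q + q * c powr (q - 1) * (t - c) \<le> t powr q"
proof (cases "c = 0 \<or> t = 0")
  case True
  show ?thesis
  proof (cases "c = 0")
    case False
    then have "t = 0" using True by simp
    have "c powr (q - 1) * c = c powr q"
      using False assms by (simp add: powr_mult_base mult.commute)
    then have "q * c powr (q - 1) * (t - c) = - (q * c powr q)"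
      unfolding \<open>t = 0\<close> by (metis diff_0 mult.assoc mult_minus_right)
    moreover have "1 * c powr q \<le> q * c powr q" using assms by (intro mult_right_mono) auto
    ultimately show ?thesis using powr_ge_zero[of t q] by linarith
  qed simp
next
  case False
  then have pos: "0 < c" "0 < t" using assms by auto
  have "(((t/c) powr q) powr (1/q)) * 1 powr (1 - 1/q) \<le> 1/q * (t/c) powr q + (1 - 1/q) * 1"
    by (rule Youngs_inequality_0) (use assms pos in auto)
  then have "t/c \<le> 1/q * (t/c) powr q + (1 - 1/q)"
    using assms pos by (simp add: powr_powr)
  then have "q * (t/c) \<le> q * (1/q * (t/c) powr q + (1 - 1/q))"
    by (rule mult_left_mono) (use assms in simp)
  then have "q * (t/c) \<le> (t/c) powr q + q - 1" using assms by (simp add: algebra_simps)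
  then have "c powr q * (q * (t/c)) \<le> c powr q * ((t/c) powr q + q - 1)"
    by (rule mult_left_mono) simp
  also have "\<dots> = c powr q * (t/c) powr q + q * c powr q - c powr q" by (simp add: algebra_simps)
  also have "c powr q * (t/c) powr q = t powr q" using pos by (simp add: powr_divide)
  finally have "c powr q * (q * (t/c)) \<le> t powr q + q * c powr q - c powr q" .
  moreover have "q * c powr (q - 1) * (t - c) = c powr q * (q * (t/c)) - q * c powr q"
    using pos by (simp add: powr_diff field_simps)
  ultimately show ?thesis by linarith
qed

text \<open>
  Minkowski's integral inequality via Jensen's inequality.  With \<open>A = \<integral> v\<close> and the probability
  density \<open>v/A\<close>, convexity of \<open>t\<^sup>q\<close> applied to \<open>g/v\<close> yields
  \<open>(\<integral> g\<^sub>s(\<eta>) ds)\<^sup>q \<le> A\<^sup>q\<^sup>-\<^sup>1 \<integral> g\<^sub>s(\<eta>)\<^sup>q v(s)\<^sup>1\<^sup>-\<^sup>q ds\<close>.  Integrating in \<open>\<eta>\<close> and exchanging the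
  integrals leaves \<open>A\<^sup>q\<^sup>-\<^sup>1 \<integral> v = A\<^sup>q\<close>.
\<close>

lemma angular_le_integral_pos:
  fixes g :: "real \<Rightarrow> real \<Rightarrow> real"
  assumes q: "1 \<le> q" and ab: "a < b"
    and g: "continuous_on ({a..b} \<times> {0..c}) (\<lambda>(s, \<eta>). g s \<eta>)"
      "\<And>s \<eta>. s \<in> {a..b} \<Longrightarrow> \<eta> \<in> {0..c} \<Longrightarrow> 0 \<le> g s \<eta>"
    and v: "continuous_on {a..b} v" "\<And>s. s \<in> {a..b} \<Longrightarrow> 0 < v s"
    and le: "\<And>s. s \<in> {a..b} \<Longrightarrow> integral {0..c} (\<lambda>\<eta>. g s \<eta> powr q) \<le> v s powr q"
  shows "integral {0..c} (\<lambda>\<eta>. integral {a..b} (\<lambda>s. g s \<eta>) powr q) \<le> integral {a..b} v powr q"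
proof -
  define A where "A = integral {a..b} v"
  define G where "G = (\<lambda>\<eta>. integral {a..b} (\<lambda>s. g s \<eta>))"
  have "0 < A"
  proof -
    obtain m where m: "m \<in> {a..b}" "\<And>s. s \<in> {a..b} \<Longrightarrow> v m \<le> v s"
      using continuous_attains_inf[OF compact_Icc _ v(1)] ab by force
    have "(b - a) * v m = integral {a..b} (\<lambda>s. v m)" using ab by simp
    also have "\<dots> \<le> A" unfolding A_def
      using m v by (intro integral_le integrable_continuous_real) auto
    finally show ?thesis using ab v(2)[OF m(1)] by (smt (verit) mult_pos_pos)
  qed
  note gs = continuous_on_slice[OF g(1)]
  have G0: "0 \<le> G \<eta>" if "\<eta> \<in> {0..c}" for \<eta>
    unfolding G_def using that g by (intro integral_nonneg integrable_continuous_real gs) auto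
  have cG: "continuous_on {0..c} G"
    unfolding G_def by (rule continuous_on_integral_parameter[OF g(1)])
  define k where "k = (\<lambda>\<eta> s. g s \<eta> powr q * v s powr (1 - q))"
  have cv: "continuous_on {a..b} (\<lambda>s. v s powr (1 - q))"
    using v by (intro continuous_intros) force+
  have "continuous_on ({a..b} \<times> {0..c}) (\<lambda>x. (case x of (s, \<eta>) \<Rightarrow> g s \<eta>) powr q)"
    by (rule continuous_on_powr_const[OF g(1)]) (use g(2) q in auto)
  then have ck: "continuous_on ({a..b} \<times> {0..c}) (\<lambda>(s, \<eta>). k \<eta> s)"
    unfolding k_def case_prod_unfold
    by (intro continuous_on_mult continuous_on_compose2[OF cv]) (auto intro!: continuous_intros)
  have ckI: "continuous_on {0..c} (\<lambda>\<eta>. integral {a..b} (k \<eta>))"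
    by (rule continuous_on_integral_parameter[OF ck])
  have point: "G \<eta> powr q \<le> A powr (q - 1) * integral {a..b} (k \<eta>)" if \<eta>: "\<eta> \<in> {0..c}" for \<eta>
  proof -
    let ?c = "G \<eta> / A"
    have c0: "0 \<le> ?c" using G0[OF \<eta>] \<open>0 < A\<close> by simp
    \<comment> \<open>The tangent at the mean value \<open>?c\<close> of \<open>g/v\<close>, multiplied by the weight; its linear term integrates to zero.\<close>
    have pt: "v s * ?c powr q + q * ?c powr (q - 1) * (g s \<eta> - v s * ?c) \<le> k \<eta> s" if s: "s \<in> {a..b}" for s
    proof -
      have "v s * (?c powr q + q * ?c powr (q - 1) * (g s \<eta> / v s - ?c)) \<le> v s * ((g s \<eta> / v s) powr q)"
        using v(2)[OF s] g(2)[OF s \<eta>] q c0 by (intro mult_left_mono powr_ge_tangent) auto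
      also have "\<dots> = k \<eta> s"
        using v(2)[OF s] g(2)[OF s \<eta>] by (simp add: k_def powr_divide powr_diff)
      finally show ?thesis using v(2)[OF s] by (simp add: algebra_simps)
    qed
    have ckl: "continuous_on {a..b} (k \<eta>)"
      unfolding k_def
      by (intro continuous_on_mult cv continuous_on_powr_const gs) (use \<eta> g q in auto)
    have vI: "(v has_integral A) {a..b}" and gI: "((\<lambda>s. g s \<eta>) has_integral G \<eta>) {a..b}"
      unfolding A_def G_def
      by (rule integrable_integral, rule integrable_continuous_real, use v(1) gs[OF \<eta>] in simp)+
    have "((\<lambda>s. v s * ?c powr q + q * ?c powr (q - 1) * (g s \<eta> - v s * ?c)) has_integral
        (A * ?c powr q + q * ?c powr (q - 1) * (G \<eta> - A * ?c))) {a..b}"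
      by (rule has_integral_add[OF has_integral_mult_left[OF vI]
            has_integral_mult_right[OF has_integral_diff[OF gI has_integral_mult_left[OF vI]]]])
    from has_integral_le[OF this integrable_integral[OF integrable_continuous_real[OF ckl]] pt]
    have "A * ?c powr q + q * ?c powr (q - 1) * (G \<eta> - A * ?c) \<le> integral {a..b} (k \<eta>)" .
    then have "A * ?c powr q \<le> integral {a..b} (k \<eta>)" using \<open>0 < A\<close> by simp
    then have "A powr (q - 1) * (A * ?c powr q) \<le> A powr (q - 1) * integral {a..b} (k \<eta>)"
      by (rule mult_left_mono) simp
    moreover have "A powr (q - 1) * (A * ?c powr q) = G \<eta> powr q"
      using \<open>0 < A\<close> G0[OF \<eta>] by (simp add: powr_divide powr_diff)
    ultimately show ?thesis by simp
  qed
  have "integral {0..c} (\<lambda>\<eta>. G \<eta> powr q)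
      \<le> integral {0..c} (\<lambda>\<eta>. A powr (q - 1) * integral {a..b} (k \<eta>))"
    by (rule integral_le)
      (use point cG G0 q ckI in \<open>auto intro!: integrable_continuous_real continuous_on_powr_const continuous_on_mult continuous_on_const\<close>)
  also have "\<dots> = A powr (q - 1) * integral {0..c} (\<lambda>\<eta>. integral {a..b} (k \<eta>))"
    by simp
  also have "integral {0..c} (\<lambda>\<eta>. integral {a..b} (k \<eta>))
      = integral {a..b} (\<lambda>s. integral {0..c} (\<lambda>\<eta>. k \<eta> s))"
    using integral_swap_continuous[of a 0 b c "\<lambda>s \<eta>. k \<eta> s"] ck by (simp add: cbox_Pair_eq)
  also have "\<dots> \<le> A"
    unfolding A_def
  proof (rule integral_le)
    have "continuous_on {a..b} (\<lambda>s. integral (cbox 0 c) (\<lambda>\<eta>. k \<eta> s))"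
      by (rule integral_continuous_on_param) (use ck in simp)
    then show "(\<lambda>s. integral {0..c} (\<lambda>\<eta>. k \<eta> s)) integrable_on {a..b}"
      by (simp add: integrable_continuous_real)
    show "v integrable_on {a..b}" using v(1) by (rule integrable_continuous_real)
    fix s assume s: "s \<in> {a..b}"
    have "integral {0..c} (\<lambda>\<eta>. k \<eta> s) = integral {0..c} (\<lambda>\<eta>. g s \<eta> powr q) * v s powr (1 - q)"
      unfolding k_def by simp
    also have "\<dots> \<le> v s powr q * v s powr (1 - q)"
      using le[OF s] by (rule mult_right_mono) simp
    also have "\<dots> = v s" using v(2)[OF s] by (simp flip: powr_add)
    finally show "integral {0..c} (\<lambda>\<eta>. k \<eta> s) \<le> v s" .
  qed
  also have "A powr (q - 1) * A = A powr q"
    using \<open>0 < A\<close> by (simp add: powr_diff)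
  finally show ?thesis unfolding G_def A_def by (simp add: mult_left_mono)
qed

text \<open>
  The weight \<open>w\<close> may vanish (for instance if the majorant is zero), so the previous lemma is
  applied to \<open>w + \<epsilon>\<close> and \<open>\<epsilon>\<close> tends to zero.
\<close>

lemma angular_le_integral:
  fixes g :: "real \<Rightarrow> real \<Rightarrow> real"
  assumes p: "1 \<le> p" 
    and g: "continuous_on ({a..b} \<times> {0..2*pi}) (\<lambda>(s, \<eta>). g s \<eta>)"
      "\<And>s \<eta>. s \<in> {a..b} \<Longrightarrow> \<eta> \<in> {0..2*pi} \<Longrightarrow> 0 \<le> g s \<eta>"
    and w: "continuous_on {a..b} w" "\<And>s. s \<in> {a..b} \<Longrightarrow> 0 \<le> w s"
    and le: "\<And>s. s \<in> {a..b} \<Longrightarrow> angular_le p (g s) (w s)"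
  shows "angular_le p (\<lambda>\<eta>. integral {a..b} (\<lambda>s. g s \<eta>)) (integral {a..b} w)"
proof (cases "p = \<infinity>")
  case True
  note gs = continuous_on_slice[OF g(1)]
  have "integral {a..b} (\<lambda>s. g s \<eta>) \<le> integral {a..b} w" if "\<eta> \<in> {0..2*pi}" for \<eta>
    by (rule integral_le) (use gs w le True that in \<open>auto simp: angular_le_def intro: integrable_continuous_real\<close>)
  then show ?thesis using True by (simp add: angular_le_def)
next
  case False
  let ?q = "enn2real p"
  have q: "1 \<le> ?q" using enn2real_ge_1[OF p False] .
  show ?thesis
  proof (cases "a < b")
    case ab: False
    then show ?thesis using False by (cases "a = b") (auto simp: angular_le_def)
  next
    case ab: True
    let ?I = "integral {0..2*pi} (\<lambda>\<eta>. integral {a..b} (\<lambda>s. g s \<eta>) powr ?q)"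
    have wi: "w integrable_on {a..b}" using w(1) by (rule integrable_continuous_real)
    have w0: "0 \<le> integral {a..b} w" using wi w(2) by (rule integral_nonneg)
    have pert: "?I \<le> (integral {a..b} w + \<epsilon> * (b - a)) powr ?q" if "0 < \<epsilon>" for \<epsilon>
    proof -
      have "?I \<le> integral {a..b} (\<lambda>s. w s + \<epsilon>) powr ?q"
      proof (rule angular_le_integral_pos[OF q ab g])
        fix s assume s: "s \<in> {a..b}"
        then have "integral {0..2*pi} (\<lambda>\<eta>. g s \<eta> powr ?q) \<le> w s powr ?q"
          using le False by (simp add: angular_le_def)
        also have "\<dots> \<le> (w s + \<epsilon>) powr ?q" using w(2)[OF s] that q by (intro powr_mono2) auto
        finally show "integral {0..2*pi} (\<lambda>\<eta>. g s \<eta> powr ?q) \<le> (w s + \<epsilon>) powr ?q" .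
        show "0 < w s + \<epsilon>" using w(2)[OF s] that by simp
      qed (auto intro!: continuous_intros w)
      also have "integral {a..b} (\<lambda>s. w s + \<epsilon>) = integral {a..b} w + \<epsilon> * (b - a)"
        using wi ab by (subst integral_add) auto
      finally show ?thesis .
    qed
    have "((\<lambda>\<epsilon>. (integral {a..b} w + \<epsilon> * (b - a)) powr ?q) \<longlongrightarrow> (integral {a..b} w + 0 * (b - a)) powr ?q) (at_right 0)"
      by (rule tendsto_powr')
        (use w0 q ab in \<open>auto intro!: tendsto_eq_intros eventually_at_rightI[of 0 1]\<close>)
    then have "?I \<le> (integral {a..b} w + 0 * (b - a)) powr ?q"
      by (rule tendsto_lowerbound) (use pert in \<open>auto intro!: eventually_at_rightI[of 0 1]\<close>)
    then show ?thesis using False by (simp add: angular_le_def)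
  qed
qed

section \<open>Poisson integrals and derivatives of disk algebra functions\<close>

text \<open>
  Arc length on the circle is invariant under rotations.  In the parametrisation by \<open>cis\<close> the
  shifted interval \<open>[\<eta>, 2\<pi> + \<eta>]\<close> is cut at \<open>2\<pi>\<close> and its second piece moved back by a period.
\<close>

lemma integral_circle_rotate:
  fixes F :: "complex \<Rightarrow> 'b::euclidean_space"
  assumes F: "continuous_on (sphere 0 1) F" and \<eta>: "\<eta> \<in> {0..2*pi}"
  shows "integral {0..2*pi} (\<lambda>\<tau>. F (cis \<tau> * cis \<eta>)) = integral {0..2*pi} (\<lambda>\<tau>. F (cis \<tau>))"
proof -
  define g where "g = (\<lambda>\<tau>. F (cis \<tau>))"
  have cg: "continuous_on S g" for S
    unfolding g_def by (rule continuous_on_compose2[OF F]) (auto intro!: continuous_intros)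
  have ig: "g integrable_on {a..b}" for a b
    by (rule integrable_continuous_real[OF cg])
  have per: "g (x + 2*pi) = g x" for x
    by (simp add: g_def flip: cis_mult)
  have shift: "integral {a..b} (\<lambda>x. g (x + c)) = integral {a+c..b+c} g" for a b c
    using integral_shift_real_ivl[of "a+c" c "b+c" g] by simp
  have "integral {0..2*pi} (\<lambda>\<tau>. F (cis \<tau> * cis \<eta>)) = integral {\<eta>..2*pi+\<eta>} g"
    using shift[of 0 "2*pi" \<eta>] by (simp add: g_def cis_mult)
  also have "\<dots> = integral {\<eta>..2*pi} g + integral {0+2*pi..\<eta>+2*pi} g"
    using \<eta> Henstock_Kurzweil_Integration.integral_combine[OF _ _ ig, of \<eta> "2*pi" "2*pi+\<eta>"]
    by (simp add: add.commute)
  also have "integral {0+2*pi..\<eta>+2*pi} g = integral {0..\<eta>} g"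
    using shift[of 0 \<eta> "2*pi"] by (simp add: per)
  also have "integral {\<eta>..2*pi} g + integral {0..\<eta>} g = integral {0..2*pi} g"
    using \<eta> Henstock_Kurzweil_Integration.integral_combine[OF _ _ ig, of 0 \<eta> "2*pi"]
    by (simp add: add.commute)
  finally show ?thesis by (simp add: g_def)
qed

text \<open>
  The factor \<open>1/(2\<pi>)\<close> is part of the kernel, so that its integral over \<open>[0, 2\<pi>]\<close> is \<open>1\<close>.
\<close>

definition poisson_kernel :: "complex \<Rightarrow> complex \<Rightarrow> real" where
  "poisson_kernel z \<zeta> = (1 - (norm z)\<^sup>2) / (norm (\<zeta> - z))\<^sup>2 / (2 * pi)"

lemma poisson_kernel_nonneg: "z \<in> ball 0 1 \<Longrightarrow> 0 \<le> poisson_kernel z \<zeta>"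
  by (simp add: poisson_kernel_def abs_square_le_1)

lemma poisson_kernel_rotate:
  "poisson_kernel (z * cis \<eta>) (\<zeta> * cis \<eta>) = poisson_kernel z \<zeta>"
proof -
  have "norm (\<zeta> * cis \<eta> - z * cis \<eta>) = norm (\<zeta> - z)"
    by (simp add: norm_mult flip: left_diff_distrib)
  then show ?thesis by (simp add: poisson_kernel_def norm_mult)
qed

lemma cis_neq_ball: "z \<in> ball 0 1 \<Longrightarrow> cis \<tau> \<noteq> z"
  by auto

lemma continuous_on_poisson_kernel:
  "z \<in> ball 0 1 \<Longrightarrow> continuous_on (sphere 0 1) (poisson_kernel z)"
  unfolding poisson_kernel_def by (intro continuous_intros) auto

lemma continuous_on_poisson_kernel_cis:
  fixes t :: "'a::topological_space \<Rightarrow> real"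
  assumes "continuous_on S t" "z \<in> ball 0 1"
  shows "continuous_on S (\<lambda>x. poisson_kernel z (cis (t x)))"
  by (rule continuous_on_compose2[OF continuous_on_poisson_kernel])
    (use assms in \<open>auto intro!: continuous_intros\<close>)

lemma Poisson_integral_eq:
  assumes "continuous_on (sphere 0 1) \<phi>" "z \<in> ball 0 1"
  shows "Poisson_integral \<phi> z = integral {0..2*pi} (\<lambda>\<tau>. \<phi> (cis \<tau>) * poisson_kernel z (cis \<tau>))"
proof -
  let ?h = "\<lambda>\<tau>. \<phi> (cis \<tau>) * ((1 - (norm z)\<^sup>2) / (norm (cis \<tau> - z))\<^sup>2)"
  have "continuous_on {0..2*pi} (\<lambda>\<tau>. \<phi> (cis \<tau>))"
    by (rule continuous_on_compose2[OF assms(1)]) (auto intro!: continuous_intros)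
  then have c: "continuous_on {0..2*pi} ?h"
    using cis_neq_ball[OF assms(2)] by (intro continuous_intros) auto
  have "integrable (lebesgue_on {0..2*pi}) ?h"
    by (rule continuous_imp_integrable_real[OF c])
  then have "Poisson_integral \<phi> z = 1 / (2*pi) * integral {0..2*pi} ?h"
    by (simp add: Poisson_integral_def lebesgue_integral_eq_integral)
  also have "\<dots> = integral {0..2*pi} (\<lambda>\<tau>. 1 / (2*pi) * ?h \<tau>)"
    by (rule integral_mult_right[symmetric])
  also have "(\<lambda>\<tau>. 1 / (2*pi) * ?h \<tau>) = (\<lambda>\<tau>. \<phi> (cis \<tau>) * poisson_kernel z (cis \<tau>))"
    by (simp add: poisson_kernel_def fun_eq_iff)
  finally show ?thesis .
qed

text \<open>
  Rotating the point is the same as rotating the boundary function.  The kernel on the right does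
  not depend on \<open>\<eta>\<close>, and therefore Minkowski's inequality in \<open>\<eta>\<close> applies to the right-hand side.
\<close>

lemma Poisson_integral_rotate:
  assumes \<phi>: "continuous_on (sphere 0 1) \<phi>" and z: "z \<in> ball 0 1" and \<eta>: "\<eta> \<in> {0..2*pi}"
  shows "Poisson_integral \<phi> (z * cis \<eta>)
    = integral {0..2*pi} (\<lambda>\<tau>. \<phi> (cis \<tau> * cis \<eta>) * poisson_kernel z (cis \<tau>))"
proof -
  have z': "z * cis \<eta> \<in> ball 0 1" using z by (simp add: norm_mult)
  have "Poisson_integral \<phi> (z * cis \<eta>)
      = integral {0..2*pi} (\<lambda>\<tau>. \<phi> (cis \<tau>) * poisson_kernel (z * cis \<eta>) (cis \<tau>))"
    by (rule Poisson_integral_eq[OF \<phi> z'])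
  also have "\<dots> = integral {0..2*pi}
      (\<lambda>\<tau>. \<phi> (cis \<tau> * cis \<eta>) * poisson_kernel (z * cis \<eta>) (cis \<tau> * cis \<eta>))"
    by (rule integral_circle_rotate[symmetric, of "\<lambda>\<zeta>. \<phi> \<zeta> * poisson_kernel (z * cis \<eta>) \<zeta>"])
      (intro continuous_on_mult \<phi> continuous_on_poisson_kernel z' \<eta>)+
  finally show ?thesis by (simp add: poisson_kernel_rotate)
qed

text \<open>
  Membership in the disk algebra with \<open>holomorphic_on\<close>, the form in which Cauchy's formulas use it.
\<close>

locale disk_algebra_function =
  fixes f :: "complex \<Rightarrow> complex"
  assumes holo: "f holomorphic_on ball 0 1" and cont: "continuous_on (cball 0 1) f"
begin

lemma cauchy_circle:
  assumes z: "z \<in> ball 0 1"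
  shows "((\<lambda>\<tau>. f (cis \<tau>) * cis \<tau> / (cis \<tau> - z)) has_integral 2 * pi * f z) {0..2*pi}"
proof -
  have "((\<lambda>u. f u / (u - z)) has_contour_integral 2 * of_real pi * \<i> * f z) (circlepath 0 1)"
    using Cauchy_integral_circlepath[OF cont holo] z by simp
  then have "((\<lambda>\<tau>. f (cis \<tau>) / (cis \<tau> - z) * \<i> * cis \<tau>) has_integral 2 * of_real pi * \<i> * f z) {0..2*pi}"
    by (simp add: circlepath_def has_contour_integral_part_circlepath_iff)
  from has_integral_mult_right[OF this, of "- \<i>"] show ?thesis
    by (simp add: field_simps)
qed

lemma cauchy_circle_deriv:
  assumes z: "z \<in> ball 0 1"
  shows "((\<lambda>\<tau>. f (cis \<tau>) * cis \<tau> / (cis \<tau> - z)\<^sup>2) has_integral 2 * pi * deriv f z) {0..2*pi}"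
proof -
  have "((\<lambda>u. f u / (u - z) ^ Suc 1) has_contour_integral 2 * pi * \<i> / fact 1 * (deriv ^^ 1) f z) (circlepath 0 1)"
    by (rule Cauchy_has_contour_integral_higher_derivative_circlepath[OF cont holo z])
  then have "((\<lambda>u. f u / (u - z)\<^sup>2) has_contour_integral 2 * of_real pi * \<i> * deriv f z) (circlepath 0 1)"
    by (simp add: numeral_2_eq_2)
  then have "((\<lambda>\<tau>. f (cis \<tau>) / (cis \<tau> - z)\<^sup>2 * \<i> * cis \<tau>) has_integral 2 * of_real pi * \<i> * deriv f z) {0..2*pi}"
    by (simp add: circlepath_def has_contour_integral_part_circlepath_iff)
  from has_integral_mult_right[OF this, of "- \<i>"] show ?thesis
    by (simp add: field_simps)
qed

lemma circle_mean: "((\<lambda>\<tau>. f (cis \<tau>)) has_integral 2 * pi * f 0) {0..2*pi}"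
  using cauchy_circle[of 0] by simp

lemma mult_disk_algebra:
  assumes "g holomorphic_on ball 0 1" "continuous_on (cball 0 1) g"
  shows "disk_algebra_function (\<lambda>u. f u * g u)"
  using assms holo cont by unfold_locales (auto intro!: holomorphic_intros continuous_intros)

end

lemma one_minus_cnj_neq_0:
  assumes "z \<in> ball 0 1" "u \<in> cball 0 1"
  shows "1 - cnj z * u \<noteq> 0"
proof
  assume "1 - cnj z * u = 0"
  then have "norm (cnj z * u) = 1" by simp
  moreover have "norm (cnj z * u) \<le> norm z * 1"
    unfolding norm_mult using assms by (intro mult_mono) auto
  ultimately show False using assms by simp
qed

text \<open>
  On the circle \<open>1 - z\<^sup>* \<zeta> = \<zeta> (\<zeta> - z)\<^sup>*\<close>, where the star denotes conjugation.  The first summand on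
  the right is the Cauchy kernel, the second one is holomorphic in \<open>\<zeta>\<close> inside the disk and vanishes
  at \<open>0\<close>.
\<close>

lemma poisson_kernel_split:
  assumes "z \<in> ball 0 1"
  shows "2 * pi * complex_of_real (poisson_kernel z (cis \<tau>))
    = cis \<tau> / (cis \<tau> - z) + cnj z * cis \<tau> / (1 - cnj z * cis \<tau>)"
proof -
  have ne: "cis \<tau> - z \<noteq> 0" "cnj (cis \<tau> - z) \<noteq> 0" "cis \<tau> \<noteq> 0" using cis_neq_ball[OF assms] 
    by (auto simp del: complex_cnj_diff)
  have c: "cis \<tau> * cnj (cis \<tau>) = 1" by (simp add: cis_cnj cis_mult)
  have "1 - cnj z * cis \<tau> = cis \<tau> * cnj (cis \<tau> - z)"
    using c by (simp add: algebra_simps)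
  then have "cnj z * cis \<tau> / (1 - cnj z * cis \<tau>) = cnj z / cnj (cis \<tau> - z)"
    using ne by (simp add: mult.commute)
  also have "cis \<tau> / (cis \<tau> - z) + cnj z / cnj (cis \<tau> - z)
      = (cis \<tau> * cnj (cis \<tau> - z) + cnj z * (cis \<tau> - z)) / ((cis \<tau> - z) * cnj (cis \<tau> - z))"
    by (rule add_frac_eq[OF ne(1,2)])
  also have "cis \<tau> * cnj (cis \<tau> - z) + cnj z * (cis \<tau> - z) = 1 - z * cnj z"
    using c by (simp add: algebra_simps)
  also have "\<dots> = of_real (1 - (norm z)\<^sup>2)"
    by (simp only: of_real_diff of_real_1 complex_norm_square)
  also have "(cis \<tau> - z) * cnj (cis \<tau> - z) = of_real ((norm (cis \<tau> - z))\<^sup>2)"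
    by (simp only: complex_norm_square)
  finally show ?thesis by (simp add: poisson_kernel_def)
qed

context disk_algebra_function
begin

text \<open>
  The integrand is the boundary function of a disk algebra function which vanishes at the origin,
  because the pole of the kernel is the reflection of \<open>z\<close> in the circle.
\<close>

lemma cauchy_circle_reflected:
  assumes z: "z \<in> ball 0 1"
  shows "((\<lambda>\<tau>. f (cis \<tau>) * (cis \<tau> / (1 - cnj z * cis \<tau>) ^ n)) has_integral 0) {0..2*pi}"
proof -
  have "disk_algebra_function (\<lambda>u. f u * (u / (1 - cnj z * u) ^ n))"
    using one_minus_cnj_neq_0[OF z]
    by (intro mult_disk_algebra) (auto intro!: holomorphic_intros continuous_intros)
  from disk_algebra_function.circle_mean[OF this] show ?thesis by simp
qed

lemma poisson_representation:
  assumes z: "z \<in> ball 0 1"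
  shows "((\<lambda>\<tau>. f (cis \<tau>) * of_real (poisson_kernel z (cis \<tau>))) has_integral f z) {0..2*pi}"
proof -
  have "((\<lambda>\<tau>. f (cis \<tau>) * cis \<tau> / (cis \<tau> - z)
        + cnj z * (f (cis \<tau>) * (cis \<tau> / (1 - cnj z * cis \<tau>) ^ 1)))
      has_integral 2 * pi * f z + cnj z * 0) {0..2*pi}"
    by (intro has_integral_add has_integral_mult_right cauchy_circle cauchy_circle_reflected z)
  also have "(\<lambda>\<tau>. f (cis \<tau>) * cis \<tau> / (cis \<tau> - z)
        + cnj z * (f (cis \<tau>) * (cis \<tau> / (1 - cnj z * cis \<tau>) ^ 1)))
      = (\<lambda>\<tau>. f (cis \<tau>) * (2 * pi * complex_of_real (poisson_kernel z (cis \<tau>))))"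
    unfolding poisson_kernel_split[OF z] by (simp add: algebra_simps)
  finally show ?thesis
    using has_integral_mult_right[of _ "2 * pi * f z" "{0..2*pi}" "1 / (2 * pi)"] by force
qed

end

lemma poisson_kernel_has_integral:
  assumes z: "z \<in> ball 0 1"
  shows "((\<lambda>\<tau>. poisson_kernel z (cis \<tau>)) has_integral 1) {0..2*pi}"
proof -
  have "disk_algebra_function (\<lambda>_. 1)" by unfold_locales auto
  from has_integral_linear[OF disk_algebra_function.poisson_representation[OF this z] bounded_linear_Re]
  show ?thesis by (simp add: o_def)
qed

context disk_algebra_function
begin

lemma continuous_on_norm_sphere: "continuous_on (sphere 0 1) (\<lambda>\<zeta>. norm (f \<zeta>))"
  by (intro continuous_on_norm continuous_on_subset[OF cont]) auto

lemma continuous_on_cis: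
  assumes "continuous_on S t"
  shows "continuous_on S (\<lambda>x. f (cis (t x)))"
  by (rule continuous_on_compose2[OF cont]) (use assms in \<open>auto intro!: continuous_intros\<close>)

text \<open>
  Choose a unimodular \<open>\<alpha>\<close> with \<open>\<alpha> f(z) = |f(z)|\<close> and put \<open>h = \<alpha> f\<close>.  In Cauchy's formula
  \<open>2\<pi> h'(z) = \<integral> h \<zeta>/(\<zeta> - z)\<^sup>2 d\<tau>\<close> one may add the conjugate of \<open>h\<close> and subtract \<open>2a\<close>, because both
  contribute zero.  Hence \<open>\<pi> |f'(z)| \<le> \<integral> |Re h - a| / |\<zeta> - z|\<^sup>2 d\<tau>\<close>, which is a Poisson integral up to
  the factor \<open>1 - |z|\<^sup>2\<close>.  Finally \<open>|Re h - a| \<le> ||f| - a| + (|f| - Re h)\<close>, and the Poisson integral of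
  the nonnegative function \<open>|f| - Re h\<close> at \<open>z\<close> is \<open>P[|f|](z) - |f(z)|\<close>.
\<close>

lemma deriv_le_Poisson:
  assumes z: "z \<in> ball 0 1"
  shows "(1 - (norm z)\<^sup>2) * norm (deriv f z)
    \<le> 2 * integral {0..2*pi} (\<lambda>\<tau>. \<bar>norm (f (cis \<tau>)) - a\<bar> * poisson_kernel z (cis \<tau>))
      + 2 * (Poisson_integral (\<lambda>\<zeta>. norm (f \<zeta>)) z - norm (f z))"
proof -
  let ?K = "\<lambda>\<tau>. poisson_kernel z (cis \<tau>)"
  define \<alpha> where "\<alpha> = (if f z = 0 then 1 else cnj (f z) / of_real (norm (f z)))"
  have \<alpha>: "norm \<alpha> = 1" "\<alpha> * f z = of_real (norm (f z))"
    using complex_norm_square[of "f z"]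
    by (auto simp: \<alpha>_def norm_divide mult.commute power2_eq_square divide_eq_eq)
  let ?h = "\<lambda>\<tau>. \<alpha> * f (cis \<tau>)"
  let ?D = "\<lambda>\<tau>. cis \<tau> / (cis \<tau> - z)\<^sup>2"
  \<comment> \<open>Conjugation turns the reflected kernel into the kernel of the derivative.\<close>
  have cD: "cnj (cis \<tau> / (1 - cnj z * cis \<tau>)\<^sup>2) = ?D \<tau>" for \<tau>
  proof -
    have "cis \<tau> - z = cis \<tau> * (1 - z * cis (-\<tau>))"
      by (simp add: algebra_simps cis_mult)
    then show ?thesis by (simp add: cis_cnj power_mult_distrib power2_eq_square divide_simps cis_mult)
  qed
  have "((\<lambda>\<tau>. \<alpha> * (f (cis \<tau>) * cis \<tau> / (cis \<tau> - z)\<^sup>2)) has_integral \<alpha> * (2 * pi * deriv f z)) {0..2*pi}"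
    by (rule has_integral_mult_right[OF cauchy_circle_deriv[OF z]])
  moreover have "((\<lambda>\<tau>. cnj \<alpha> * cnj (f (cis \<tau>)  * (cis \<tau> / (1 - cnj z * cis \<tau>)\<^sup>2))) has_integral cnj \<alpha> * 0) {0..2*pi}"
    using has_integral_linear[OF cauchy_circle_reflected[OF z, of 2] bounded_linear_cnj]
    by (intro has_integral_mult_right) (simp add: o_def)
  moreover have "((\<lambda>\<tau>. 2 * of_real a * (1 * cis \<tau> / (cis \<tau> - z)\<^sup>2)) has_integral 2 * of_real a * (2 * pi * deriv (\<lambda>_. 1) z)) {0..2*pi}"
    by (rule has_integral_mult_right, rule disk_algebra_function.cauchy_circle_deriv)
      (use z in \<open>auto simp: disk_algebra_function_def\<close>)
  ultimately have "((\<lambda>\<tau>. \<alpha> * (f (cis \<tau>) * cis \<tau> / (cis \<tau> - z)\<^sup>2)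
        + cnj \<alpha> * cnj (f (cis \<tau>)  * (cis \<tau> / (1 - cnj z * cis \<tau>)\<^sup>2))
        - 2 * of_real a * (1 * cis \<tau> / (cis \<tau> - z)\<^sup>2))
      has_integral \<alpha> * (2 * pi * deriv f z) + cnj \<alpha> * 0 - 2 * of_real a * (2 * pi * deriv (\<lambda>_. 1) z)) {0..2*pi}"
    by (intro has_integral_add has_integral_diff)
  also have "(\<lambda>\<tau>. \<alpha> * (f (cis \<tau>) * cis \<tau> / (cis \<tau> - z)\<^sup>2)
        + cnj \<alpha> * cnj (f (cis \<tau>)  * (cis \<tau> / (1 - cnj z * cis \<tau>)\<^sup>2))
        - 2 * of_real a * (1 * cis \<tau> / (cis \<tau> - z)\<^sup>2))
      = (\<lambda>\<tau>. of_real (2 * (Re (?h \<tau>) - a)) * ?D \<tau>)"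
  proof
    fix \<tau>
    have "\<alpha> * (f (cis \<tau>) * cis \<tau> / (cis \<tau> - z)\<^sup>2)
        + cnj \<alpha> * cnj (f (cis \<tau>)  * (cis \<tau> / (1 - cnj z * cis \<tau>)\<^sup>2))
        - 2 * of_real a * (1 * cis \<tau> / (cis \<tau> - z)\<^sup>2)
      = ((?h \<tau> + cnj (?h \<tau>)) - 2 * of_real a) * ?D \<tau>"
      unfolding complex_cnj_mult[of "f (cis \<tau>)"] cD by (simp add: algebra_simps)
    also have "(?h \<tau> + cnj (?h \<tau>)) - 2 * of_real a = of_real (2 * (Re (?h \<tau>) - a))"
      unfolding complex_add_cnj by simp
    finally show "\<alpha> * (f (cis \<tau>) * cis \<tau> / (cis \<tau> - z)\<^sup>2)
        + cnj \<alpha> * cnj (f (cis \<tau>)  * (cis \<tau> / (1 - cnj z * cis \<tau>)\<^sup>2))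
        - 2 * of_real a * (1 * cis \<tau> / (cis \<tau> - z)\<^sup>2) = of_real (2 * (Re (?h \<tau>) - a)) * ?D \<tau>" .
  qed
  finally have I: "((\<lambda>\<tau>. of_real (2 * (Re (?h \<tau>) - a)) * ?D \<tau>) has_integral \<alpha> * (2 * pi * deriv f z)) {0..2*pi}"
    by simp
  define c where "c = (1 - (norm z)\<^sup>2) / (2*pi)"
  have c0: "0 \<le> c" using z by (simp add: c_def abs_square_le_1)
  have cK: "continuous_on {0..2*pi} ?K"
    by (rule continuous_on_poisson_kernel_cis[OF _ z]) (auto intro: continuous_intros)
  have cf: "continuous_on {0..2*pi} (\<lambda>\<tau>. f (cis \<tau>))"
    by (rule continuous_on_cis) (auto intro: continuous_intros)
  have PI: "((\<lambda>\<tau>. norm (f (cis \<tau>)) * ?K \<tau>) has_integral Poisson_integral (\<lambda>\<zeta>. norm (f \<zeta>)) z) {0..2*pi}"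
    unfolding Poisson_integral_eq[OF continuous_on_norm_sphere z]
    by (intro integrable_integral integrable_continuous_real continuous_intros cf cK)
  have "((\<lambda>\<tau>. \<alpha> * (f (cis \<tau>) * of_real (?K \<tau>))) has_integral \<alpha> * f z) {0..2*pi}"
    by (rule has_integral_mult_right[OF poisson_representation[OF z]])
  from has_integral_linear[OF this bounded_linear_Re]
  have RI: "((\<lambda>\<tau>. Re (?h \<tau>) * ?K \<tau>) has_integral norm (f z)) {0..2*pi}"
    unfolding \<alpha>(2) by (simp add: o_def algebra_simps)
  have AI: "((\<lambda>\<tau>. \<bar>norm (f (cis \<tau>)) - a\<bar> * ?K \<tau>) has_integral
      integral {0..2*pi} (\<lambda>\<tau>. \<bar>norm (f (cis \<tau>)) - a\<bar> * ?K \<tau>)) {0..2*pi}"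
    by (intro integrable_integral integrable_continuous_real continuous_intros cf cK)
  let ?g = "\<lambda>\<tau>. c *\<^sub>R (of_real (2 * (Re (?h \<tau>) - a)) * ?D \<tau>)"
  have J: "(?g has_integral c *\<^sub>R (\<alpha> * (2 * pi * deriv f z))) {0..2*pi}"
    by (rule has_integral_cmul[OF I])
  have "norm (integral {0..2*pi} ?g)
      \<le> integral {0..2*pi} (\<lambda>\<tau>. 2 * (\<bar>norm (f (cis \<tau>)) - a\<bar> * ?K \<tau>) + 2 * (norm (f (cis \<tau>)) * ?K \<tau> - Re (?h \<tau>) * ?K \<tau>))"
  proof (rule integral_norm_bound_integral)
    show "?g integrable_on {0..2*pi}" using J by blast
    show "((\<lambda>\<tau>. 2 * (\<bar>norm (f (cis \<tau>)) - a\<bar> * ?K \<tau>) + 2 * (norm (f (cis \<tau>)) * ?K \<tau> - Re (?h \<tau>) * ?K \<tau>))) integrable_on {0..2*pi}"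
      by (intro integrable_continuous_real continuous_intros cf cK)
    fix \<tau>
    have "Re (?h \<tau>) \<le> norm (f (cis \<tau>))"
      using complex_Re_le_cmod[of "?h \<tau>"] \<alpha>(1) by (simp add: norm_mult)
    then have *: "\<bar>Re (?h \<tau>) - a\<bar> \<le> \<bar>norm (f (cis \<tau>)) - a\<bar> + (norm (f (cis \<tau>)) - Re (?h \<tau>))"
      by linarith
    have "0 \<le> 1 - (norm z)\<^sup>2" using z by (simp add: abs_square_le_1)
    then have "norm (c *\<^sub>R (of_real (2 * y) * ?D \<tau>)) = 2 * (\<bar>y\<bar> * ?K \<tau>)" for y
      by (simp add: norm_divide norm_mult norm_power poisson_kernel_def c_def abs_mult mult.commute)
    then have "norm (?g \<tau>) = 2 * (\<bar>Re (?h \<tau>) - a\<bar> * ?K \<tau>)" .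
    also have "\<dots> \<le> 2 * ((\<bar>norm (f (cis \<tau>)) - a\<bar> + (norm (f (cis \<tau>)) - Re (?h \<tau>))) * ?K \<tau>)"
      by (intro mult_left_mono mult_right_mono * poisson_kernel_nonneg z) simp
    finally show "norm (?g \<tau>)
        \<le> 2 * (\<bar>norm (f (cis \<tau>)) - a\<bar> * ?K \<tau>) + 2 * (norm (f (cis \<tau>)) * ?K \<tau> - Re (?h \<tau>) * ?K \<tau>)"
      by (simp add: algebra_simps)
  qed
  also have "\<dots> = 2 * integral {0..2*pi} (\<lambda>\<tau>. \<bar>norm (f (cis \<tau>)) - a\<bar> * ?K \<tau>)
      + 2 * (Poisson_integral (\<lambda>\<zeta>. norm (f \<zeta>)) z - norm (f z))"
    by (rule integral_unique)
      (intro has_integral_add has_integral_mult_right has_integral_diff AI PI RI)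
  also have "norm (integral {0..2*pi} ?g) = (1 - (norm z)\<^sup>2) * norm (deriv f z)"
    unfolding integral_unique[OF J] using c0 \<alpha>(1) by (simp add: norm_mult) (simp add: c_def)
  finally show ?thesis .
qed

end

section \<open>Regular majorants\<close>

text \<open>
  The end points of the interval form a null set, so an open interval suffices on the right.
\<close>

lemma integral_le_nn_integral:
  fixes h :: "real \<Rightarrow> real"
  assumes h: "continuous_on {a..b} h" "\<And>t. t \<in> {a..b} \<Longrightarrow> 0 \<le> h t" and S: "{a<..<b} \<subseteq> S"
  shows "ennreal (integral {a..b} h) \<le> (\<integral>\<^sup>+t\<in>S. ennreal (h t) \<partial>lborel)"
proof -
  have "ennreal (integral {a..b} h) = (\<integral>\<^sup>+t. ennreal (h t) * indicator {a..b} t \<partial>lborel)"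
    by (rule nn_integral_has_integral_lebesgue'[symmetric])
      (use h in \<open>auto intro: integrable_integral integrable_continuous_real\<close>)
  also have "\<dots> \<le> (\<integral>\<^sup>+t\<in>S. ennreal (h t) \<partial>lborel)"
  proof (rule nn_integral_mono_AE)
    show "AE t in lborel. ennreal (h t) * indicator {a..b} t \<le> ennreal (h t) * indicator S t"
      using AE_lborel_singleton[of a] AE_lborel_singleton[of b]
    proof eventually_elim
      case (elim t)
      then have "t \<in> S" if "t \<in> {a..b}" using S that by (intro subsetD[OF S]) auto
      then show ?case by (cases "t \<in> {a..b}") (auto simp: indicator_def)
    qed
  qed
  finally show ?thesis .
qed

text \<open>
  These substitutions match the bound \<open>|cis \<tau> - r| \<ge> \<tau>/\<pi>\<close> on the upper half circle and its mirror
  image \<open>|cis \<tau> - r| \<ge> 2 - \<tau>/\<pi>\<close> on the lower one.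
\<close>

lemma has_integral_rescale_period:
  fixes g :: "real \<Rightarrow> real"
  assumes "(g has_integral I) {0..2}"
  shows "((\<lambda>\<tau>. g (\<tau> / pi)) has_integral pi * I) {0..2*pi}"
    and "((\<lambda>\<tau>. g (2 - \<tau> / pi)) has_integral pi * I) {0..2*pi}"
proof -
  have "(\<lambda>x. x / (1/pi)) ` {0..2} = {0..2*pi}"
    by (auto simp: image_def field_simps intro!: bexI[of _ "_ / pi"])
  then show A: "((\<lambda>\<tau>. g (\<tau> / pi)) has_integral pi * I) {0..2*pi}"
    using has_integral_stretch_real[OF assms, of "1/pi"] by simp
  then have "((\<lambda>\<tau>. g (- \<tau> / pi)) has_integral pi * I) {-(2*pi)..-0}"
    by (subst (asm) has_integral_reflect_real[symmetric]) simp
  from has_integral_shift_real_ivl[OF this, of "-(2*pi)"]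
  show "((\<lambda>\<tau>. g (2 - \<tau> / pi)) has_integral pi * I) {0..2*pi}"
    by (simp add: diff_divide_distrib)
qed

text \<open>
  By Jordan's inequality \<open>|cis \<tau> - 1| = 2 sin (\<tau>/2) \<ge> 2\<tau>/\<pi>\<close>, and \<open>|cis \<tau> - 1| \<le> 2 |cis \<tau> - r|\<close> because
  \<open>1 - r\<close> is the distance of \<open>r\<close> from the circle.
\<close>

lemma norm_cis_minus_of_real_ge:
  assumes r: "0 \<le> r" "r \<le> 1" and \<tau>: "\<tau> \<in> {0..pi}"
  shows "\<tau> / pi \<le> norm (cis \<tau> - of_real r)"
proof -
  have J: "2 * x \<le> pi * sin x" if "0 \<le> x" "x \<le> pi/2" for x :: real
  proof -
    have "convex_on {0..pi/2} (\<lambda>x. - sin x)"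
      by (rule f''_ge0_imp_convex[where f'="\<lambda>x. - cos x" and f''=sin])
        (auto intro!: derivative_eq_intros sin_ge_zero)
    from convex_onD[OF this, of "2 * x / pi" 0 "pi/2"] show ?thesis
      using that by (simp add: field_simps)
  qed
  have "(norm (cis \<tau> - 1))\<^sup>2 = (cos \<tau> - 1)\<^sup>2 + (sin \<tau>)\<^sup>2"
    by (simp add: cmod_power2)
  also have "\<dots> = 2 - 2 * cos \<tau>"
    using sin_cos_squared_add[of \<tau>] by (simp add: power2_eq_square algebra_simps)
  also have "\<dots> = (2 * sin (\<tau>/2))\<^sup>2"
    using cos_double_sin[of "\<tau>/2"] by (simp add: power_mult_distrib)
  finally have "norm (cis \<tau> - 1) = 2 * sin (\<tau>/2)"
    by (rule power2_eq_imp_eq) (use \<tau> in \<open>auto intro!: sin_ge_zero\<close>)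
  then have "2 * \<tau> / pi \<le> norm (cis \<tau> - 1)"
    using J[of "\<tau>/2"] \<tau> by (simp add: field_simps)
  also have "\<dots> \<le> norm (cis \<tau> - of_real r) + norm (of_real r - (1::complex))"
    using norm_triangle_ineq[of "cis \<tau> - of_real r" "of_real r - 1"] by simp
  also have "norm (of_real r - (1::complex)) = norm (cis \<tau>) - norm (of_real r :: complex)"
    using r norm_of_real[of "r - 1", where ?'a = complex] by simp
  also have "\<dots> \<le> norm (cis \<tau> - of_real r)" by (rule norm_triangle_ineq2)
  finally show ?thesis by simp
qed

locale regularity =
  fixes \<omega> :: "real \<Rightarrow> real"
  assumes regular: "regular_majorant \<omega>"
begin

lemma nonneg: "0 \<le> t \<Longrightarrow> 0 \<le> \<omega> t"
  and continuous: "continuous_on {0..} \<omega>"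
  and zero: "\<omega> 0 = 0"
  using regular by (auto simp: regular_majorant_def majorant_def)

lemma mono: "0 \<le> s \<Longrightarrow> s \<le> t \<Longrightarrow> \<omega> s \<le> \<omega> t"
  using regular by (auto simp: regular_majorant_def majorant_def mono_on_def)

lemma ratio_antimono: "0 < s \<Longrightarrow> s \<le> t \<Longrightarrow> \<omega> t / t \<le> \<omega> s / s"
  using regular by (auto simp: regular_majorant_def majorant_def monotone_on_def)

lemma scale: "1 \<le> c \<Longrightarrow> 0 \<le> t \<Longrightarrow> \<omega> (c * t) \<le> c * \<omega> t"
  using ratio_antimono[of t "c * t"] by (cases "t = 0") (auto simp: zero field_simps)

lemma ratio_square_antimono:
  assumes "0 < s" "s \<le> t"
  shows "\<omega> t / t\<^sup>2 \<le> \<omega> s / s\<^sup>2"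
proof -
  have "\<omega> t / t / t \<le> \<omega> s / s / s"
    by (rule frac_le) (use assms ratio_antimono[OF assms] nonneg[of s] in auto)
  then show ?thesis by (simp add: power2_eq_square)
qed

lemma ratio_nonneg: "0 < t \<Longrightarrow> 0 \<le> \<omega> t / t"
  and ratio_square_nonneg: "0 < t \<Longrightarrow> 0 \<le> \<omega> t / t\<^sup>2"
  using nonneg[of t] by auto

lemma continuous_on_comp:
  assumes "continuous_on S h" "\<And>x. x \<in> S \<Longrightarrow> 0 \<le> h x"
  shows "continuous_on S (\<lambda>x. \<omega> (h x))"
  by (rule continuous_on_compose2[OF continuous assms(1)]) (use assms(2) in auto)

lemma continuous_on_ratio: "0 < a \<Longrightarrow> continuous_on {a..b} (\<lambda>t. \<omega> t / t)"
  and continuous_on_ratio_square: "0 < a \<Longrightarrow> continuous_on {a..b} (\<lambda>t. \<omega> t / t\<^sup>2)"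
  by (auto intro!: continuous_on_divide continuous_on_comp continuous_intros)

text \<open>
  The regularity conditions in terms of integrals over compact intervals away from \<open>0\<close>, where the
  integrands are continuous.
\<close>

lemma regularity_constant:
  obtains \<delta>\<^sub>1 M where "0 < \<delta>\<^sub>1" "\<delta>\<^sub>1 \<le> 1" "0 < M"
    "\<And>\<epsilon> \<delta>. 0 < \<epsilon> \<Longrightarrow> \<delta> \<le> \<delta>\<^sub>1 \<Longrightarrow> \<epsilon> \<le> \<delta> \<Longrightarrow> integral {\<epsilon>..\<delta>} (\<lambda>t. \<omega> t / t) \<le> M * \<omega> \<delta>"
    "\<And>\<delta> R. 0 < \<delta> \<Longrightarrow> \<delta> \<le> \<delta>\<^sub>1 \<Longrightarrow> \<delta> * integral {\<delta>..R} (\<lambda>t. \<omega> t / t\<^sup>2) \<le> M * \<omega> \<delta>"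
proof -
  obtain \<delta>\<^sub>0 M where "0 < \<delta>\<^sub>0" and M: "0 < M" and
    reg: "\<And>\<delta>. 0 < \<delta> \<Longrightarrow> \<delta> < \<delta>\<^sub>0 \<Longrightarrow>
        (\<integral>\<^sup>+t\<in>{0<..<\<delta>}. ennreal (\<omega> t / t) \<partial>lborel) \<le> ennreal (M * \<omega> \<delta>) \<and>
        ennreal \<delta> * (\<integral>\<^sup>+t\<in>{\<delta><..}. ennreal (\<omega> t / t\<^sup>2) \<partial>lborel) \<le> ennreal (M * \<omega> \<delta>)"
    using regular by (auto simp: regular_majorant_def)
  define \<delta>\<^sub>1 where "\<delta>\<^sub>1 = min (\<delta>\<^sub>0 / 2) 1"
  have \<delta>\<^sub>1: "0 < \<delta>\<^sub>1" "\<delta>\<^sub>1 \<le> 1" "\<delta>\<^sub>1 < \<delta>\<^sub>0" using \<open>0 < \<delta>\<^sub>0\<close> by (auto simp: \<delta>\<^sub>1_def)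
  show ?thesis
  proof (rule that[OF \<delta>\<^sub>1(1,2) M])
    fix \<epsilon> \<delta> :: real assume *: "0 < \<epsilon>" "\<delta> \<le> \<delta>\<^sub>1" "\<epsilon> \<le> \<delta>"
    have "ennreal (integral {\<epsilon>..\<delta>} (\<lambda>t. \<omega> t / t)) \<le> (\<integral>\<^sup>+t\<in>{0<..<\<delta>}. ennreal (\<omega> t / t) \<partial>lborel)"
      by (rule integral_le_nn_integral[OF continuous_on_ratio ratio_nonneg]) (use * in auto)
    also have "\<dots> \<le> ennreal (M * \<omega> \<delta>)" using reg[of \<delta>] * \<delta>\<^sub>1 by auto
    finally show "integral {\<epsilon>..\<delta>} (\<lambda>t. \<omega> t / t) \<le> M * \<omega> \<delta>"
      using M nonneg[of \<delta>] * by (subst (asm) ennreal_le_iff) auto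
  next
    fix \<delta> R :: real assume *: "0 < \<delta>" "\<delta> \<le> \<delta>\<^sub>1"
    have "ennreal (\<delta> * integral {\<delta>..R} (\<lambda>t. \<omega> t / t\<^sup>2))
        = ennreal \<delta> * ennreal (integral {\<delta>..R} (\<lambda>t. \<omega> t / t\<^sup>2))"
      using * by (simp add: ennreal_mult')
    also have "\<dots> \<le> ennreal \<delta> * (\<integral>\<^sup>+t\<in>{\<delta><..}. ennreal (\<omega> t / t\<^sup>2) \<partial>lborel)"
      by (intro mult_left_mono integral_le_nn_integral[OF continuous_on_ratio_square ratio_square_nonneg]) (use * in auto)
    also have "\<dots> \<le> ennreal (M * \<omega> \<delta>)" using reg[of \<delta>] * \<delta>\<^sub>1 by auto
    finally show "\<delta> * integral {\<delta>..R} (\<lambda>t. \<omega> t / t\<^sup>2) \<le> M * \<omega> \<delta>"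
      using M nonneg[of \<delta>] * by (subst (asm) ennreal_le_iff) auto
  qed
qed

text \<open>
  For \<open>\<delta>\<close> between the threshold \<open>\<delta>\<^sub>1\<close> of the regularity condition and \<open>1\<close>, the additional part of
  the integral is at most \<open>\<omega>(\<delta>)/\<delta>\<^sub>1\<close> by monotonicity of \<open>\<omega>\<close>.
\<close>

lemma integral_ratio_le:
  obtains C where "0 < C"
    "\<And>\<epsilon> \<delta>. 0 < \<epsilon> \<Longrightarrow> \<epsilon> \<le> \<delta> \<Longrightarrow> \<delta> \<le> 1 \<Longrightarrow> integral {\<epsilon>..\<delta>} (\<lambda>t. \<omega> t / t) \<le> C * \<omega> \<delta>"
proof -
  obtain \<delta>\<^sub>1 M where *: "0 < \<delta>\<^sub>1" "\<delta>\<^sub>1 \<le> 1" "0 < M"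
    and small: "\<And>\<epsilon> \<delta>. 0 < \<epsilon> \<Longrightarrow> \<delta> \<le> \<delta>\<^sub>1 \<Longrightarrow> \<epsilon> \<le> \<delta> \<Longrightarrow> integral {\<epsilon>..\<delta>} (\<lambda>t. \<omega> t / t) \<le> M * \<omega> \<delta>"
    by (rule regularity_constant) blast
  have "integral {\<epsilon>..\<delta>} (\<lambda>t. \<omega> t / t) \<le> (M + 1 / \<delta>\<^sub>1) * \<omega> \<delta>"
    if "0 < \<epsilon>" "\<epsilon> \<le> \<delta>" "\<delta> \<le> 1" for \<epsilon> \<delta>
  proof (cases "\<delta> \<le> \<delta>\<^sub>1")
    case True
    then show ?thesis using small[of \<epsilon> \<delta>] that * divide_nonneg_pos[OF nonneg[of \<delta>], of \<delta>\<^sub>1]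
      by (simp add: algebra_simps)
  next
    case False
    define m where "m = min \<epsilon> \<delta>\<^sub>1"
    have m: "0 < m" "m \<le> \<epsilon>" "m \<le> \<delta>\<^sub>1" using that * by (auto simp: m_def)
    have int: "(\<lambda>t. \<omega> t / t) integrable_on {a..b}" if "0 < a" for a b
      using that by (intro integrable_continuous_real continuous_on_ratio)
    have "integral {\<epsilon>..\<delta>} (\<lambda>t. \<omega> t / t) \<le> integral {m..\<delta>} (\<lambda>t. \<omega> t / t)"
      by (intro integral_subset_le int) (use m that in \<open>auto intro!: ratio_nonneg simp del: zero_le_divide_iff\<close>)
    also have "\<dots> = integral {m..\<delta>\<^sub>1} (\<lambda>t. \<omega> t / t) + integral {\<delta>\<^sub>1..\<delta>} (\<lambda>t. \<omega> t / t)"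
      using False by (intro Henstock_Kurzweil_Integration.integral_combine[symmetric] int m) auto
    also have "integral {m..\<delta>\<^sub>1} (\<lambda>t. \<omega> t / t) \<le> M * \<omega> \<delta>\<^sub>1"
      using m by (intro small) auto
    also have "\<omega> \<delta>\<^sub>1 \<le> \<omega> \<delta>" using False * by (intro mono) auto
    also have "integral {\<delta>\<^sub>1..\<delta>} (\<lambda>t. \<omega> t / t) \<le> integral {\<delta>\<^sub>1..\<delta>} (\<lambda>t. \<omega> \<delta> / \<delta>\<^sub>1)"
      by (intro integral_le int frac_le mono nonneg) (use * in auto)
    also have "\<dots> = (\<delta> - \<delta>\<^sub>1) * (\<omega> \<delta> / \<delta>\<^sub>1)" using False by simp
    also have "\<dots> \<le> 1 * (\<omega> \<delta> / \<delta>\<^sub>1)"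
      using that * nonneg[of \<delta>] by (intro mult_right_mono) auto
    finally show ?thesis using * by (simp add: algebra_simps)
  qed
  then show ?thesis using that[of "M + 1 / \<delta>\<^sub>1"] * by (simp add: add_pos_pos)
qed

text \<open>
  For \<open>\<delta>\<close> above the threshold \<open>\<delta>\<^sub>1\<close> the integral only shrinks, while the factor \<open>\<delta>\<close> grows at most
  from \<open>\<delta>\<^sub>1\<close> to \<open>1\<close>.
\<close>

lemma integral_ratio_square_le:
  obtains C where "0 < C"
    "\<And>\<delta> R. 0 < \<delta> \<Longrightarrow> \<delta> \<le> 1 \<Longrightarrow> \<delta> * integral {\<delta>..R} (\<lambda>t. \<omega> t / t\<^sup>2) \<le> C * \<omega> \<delta>"
proof -
  obtain \<delta>\<^sub>1 M where *: "0 < \<delta>\<^sub>1" "\<delta>\<^sub>1 \<le> 1" "0 < M"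
    and small: "\<And>\<delta> R. 0 < \<delta> \<Longrightarrow> \<delta> \<le> \<delta>\<^sub>1 \<Longrightarrow> \<delta> * integral {\<delta>..R} (\<lambda>t. \<omega> t / t\<^sup>2) \<le> M * \<omega> \<delta>"
    by (rule regularity_constant) blast
  have "\<delta> * integral {\<delta>..R} (\<lambda>t. \<omega> t / t\<^sup>2) \<le> (M / \<delta>\<^sub>1) * \<omega> \<delta>"
    if "0 < \<delta>" "\<delta> \<le> 1" for \<delta> R
  proof -
    define m where "m = min \<delta> \<delta>\<^sub>1"
    have m: "0 < m" "m \<le> \<delta>" "m \<le> \<delta>\<^sub>1" using that * by (auto simp: m_def)
    have "\<delta>\<^sub>1 * \<delta> \<le> 1 * \<delta>" "\<delta>\<^sub>1 * \<delta> \<le> \<delta>\<^sub>1 * 1"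
      using that * by (intro mult_mono; simp)+
    then have mul: "\<delta>\<^sub>1 * \<delta> \<le> m" by (simp add: m_def)
    have int: "(\<lambda>t. \<omega> t / t\<^sup>2) integrable_on {a..b}" if "0 < a" for a b
      using that by (intro integrable_continuous_real continuous_on_ratio_square)
    have le: "integral {\<delta>..R} (\<lambda>t. \<omega> t / t\<^sup>2) \<le> integral {m..R} (\<lambda>t. \<omega> t / t\<^sup>2)"
      by (intro integral_subset_le int) (use m that in \<open>auto intro!: ratio_square_nonneg simp del: zero_le_divide_iff\<close>)
    have I0: "0 \<le> integral {\<delta>..R} (\<lambda>t. \<omega> t / t\<^sup>2)"
      by (intro integral_nonneg int) (use that in \<open>auto intro!: ratio_square_nonneg simp del: zero_le_divide_iff\<close>)
    have "\<delta>\<^sub>1 * (\<delta> * integral {\<delta>..R} (\<lambda>t. \<omega> t / t\<^sup>2)) \<le> m * integral {\<delta>..R} (\<lambda>t. \<omega> t / t\<^sup>2)"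
      using mult_right_mono[OF mul I0] by (simp add: mult.assoc)
    also have "\<dots> \<le> m * integral {m..R} (\<lambda>t. \<omega> t / t\<^sup>2)"
      using le m by (intro mult_left_mono) auto
    also have "\<dots> \<le> M * \<omega> m" using m by (intro small) auto
    also have "\<dots> \<le> M * \<omega> \<delta>" using m * by (intro mult_left_mono mono) auto
    finally show ?thesis using * by (simp add: field_simps)
  qed
  then show ?thesis using that[of "M / \<delta>\<^sub>1"] * by simp
qed

text \<open>
  The product \<open>\<omega>(|\<zeta> - r|) (1 - r\<^sup>2)/|\<zeta> - r|\<^sup>2\<close> is at most \<open>2d\<close> times the nonincreasing function
  \<open>\<omega>(t)/t\<^sup>2\<close> at \<open>t = |\<zeta> - r|\<close>, where \<open>d = 1 - r\<close>.  Since \<open>|\<zeta> - r|\<close> is at least \<open>d\<close> and at least the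
  angular distance of \<open>\<zeta>\<close> from \<open>1\<close> divided by \<open>\<pi>\<close>, the average over the circle is bounded by \<open>2d\<close> times
  the integral of \<open>\<omega>(t)/t\<^sup>2\<close> over \<open>[0, 2]\<close>, with the integrand kept constant below \<open>d\<close>.  The constant
  part contributes \<open>\<omega>(d)/d\<close>, the rest is
  \<open>O(\<omega>(d)/d)\<close> by regularity.
\<close>

lemma Poisson_majorant_real:
  obtains C where "0 < C"
    "\<And>r. 0 \<le> r \<Longrightarrow> r < 1 \<Longrightarrow>
      integral {0..2*pi} (\<lambda>\<tau>. \<omega> (norm (cis \<tau> - of_real r)) * poisson_kernel (of_real r) (cis \<tau>)) \<le> C * \<omega> (1 - r)"
proof -
  obtain C where C: "0 < C" and
    reg: "\<And>\<delta> R. 0 < \<delta> \<Longrightarrow> \<delta> \<le> 1 \<Longrightarrow> \<delta> * integral {\<delta>..R} (\<lambda>t. \<omega> t / t\<^sup>2) \<le> C * \<omega> \<delta>"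
    by (rule integral_ratio_square_le) blast
  have "integral {0..2*pi} (\<lambda>\<tau>. \<omega> (norm (cis \<tau> - of_real r)) * poisson_kernel (of_real r) (cis \<tau>)) \<le> 2 * (1 + C) * \<omega> (1 - r)"
    if r: "0 \<le> r" "r < 1" for r
  proof -
    define d where "d = 1 - r"
    have d: "0 < d" "d \<le> 1" using r by (auto simp: d_def)
    define g where "g = (\<lambda>t. \<omega> (max d t) / (max d t)\<^sup>2)"
    define N where "N = (\<lambda>\<tau>. norm (cis \<tau> - of_real r))"
    have Nd: "d \<le> N \<tau>" for \<tau>
      using norm_triangle_ineq2[of "cis \<tau>" "of_real r"] r by (simp add: N_def d_def)
    have sym: "N (2*pi - \<tau>) = N \<tau>" for \<tau>
    proof -
      have "cis (2*pi - \<tau>) - of_real r = cnj (cis \<tau> - of_real r)"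
        by (simp add: complex_eq_iff cos_diff sin_diff)
      then show ?thesis unfolding N_def by (simp only: complex_mod_cnj)
    qed
    have g0: "0 \<le> g t" for t using nonneg[of "max d t"] d by (simp add: g_def)
    have Ng: "\<omega> (N \<tau>) / (N \<tau>)\<^sup>2 \<le> g (\<tau> / pi) + g (2 - \<tau> / pi)" if "\<tau> \<in> {0..2*pi}" for \<tau>
    proof (cases "\<tau> \<le> pi")
      case True
      then have "max d (\<tau> / pi) \<le> N \<tau>"
        using norm_cis_minus_of_real_ge[of r \<tau>] that r Nd by (simp add: N_def)
      then have "\<omega> (N \<tau>) / (N \<tau>)\<^sup>2 \<le> g (\<tau> / pi)"
        unfolding g_def using d by (intro ratio_square_antimono) auto
      then show ?thesis using g0[of "2 - \<tau> / pi"] by simp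
    next
      case False
      then have "max d ((2*pi - \<tau>) / pi) \<le> N (2*pi - \<tau>)"
        using norm_cis_minus_of_real_ge[of r "2*pi - \<tau>"] that r Nd by (simp add: N_def)
      then have "\<omega> (N \<tau>) / (N \<tau>)\<^sup>2 \<le> g ((2*pi - \<tau>) / pi)"
        unfolding g_def sym using d by (intro ratio_square_antimono) auto
      then show ?thesis using g0[of "\<tau> / pi"] by (simp add: diff_divide_distrib)
    qed
    have cg: "continuous_on S g" for S
      unfolding g_def using d
      by (intro continuous_on_divide continuous_on_comp continuous_intros) auto
    have I: "integral {0..2} g \<le> (1 + C) * \<omega> d / d"
    proof -
      have "integral {0..2} g = integral {0..d} g + integral {d..2} g"
        using d by (intro Henstock_Kurzweil_Integration.integral_combine[symmetric]
            integrable_continuous_real cg) auto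
      also have "integral {0..d} g = integral {0..d} (\<lambda>t. \<omega> d / d\<^sup>2)"
        by (rule integral_cong) (simp add: g_def)
      also have "\<dots> = \<omega> d / d" using d by (simp add: power2_eq_square)
      also have "integral {d..2} g = integral {d..2} (\<lambda>t. \<omega> t / t\<^sup>2)"
        by (rule integral_cong) (simp add: g_def)
      also have "\<dots> \<le> C * \<omega> d / d" using reg[OF d, of 2] d by (simp add: field_simps)
      finally show ?thesis by (simp add: algebra_simps add_divide_distrib)
    qed
    have gI: "(g has_integral integral {0..2} g) {0..2}"
      by (intro integrable_integral integrable_continuous_real cg)
    have N0: "0 < N \<tau>" for \<tau> using Nd[of \<tau>] d by simp
    have N1: "N \<tau> \<noteq> 0" for \<tau> using N0[of \<tau>] by simp
    have cN: "continuous_on S N" for S unfolding N_def by (intro continuous_intros)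
    have "integral {0..2*pi} (\<lambda>\<tau>. \<omega> (N \<tau>) * poisson_kernel (of_real r) (cis \<tau>))
        \<le> integral {0..2*pi} (\<lambda>\<tau>. d / pi * (g (\<tau> / pi) + g (2 - \<tau> / pi)))"
    proof (rule integral_le)
      have "poisson_kernel (of_real r) (cis \<tau>) = (1 - r\<^sup>2) / (N \<tau>)\<^sup>2 / (2*pi)" for \<tau>
        by (simp add: poisson_kernel_def N_def)
      moreover have "continuous_on {0..2*pi} (\<lambda>\<tau>. \<omega> (N \<tau>) * ((1 - r\<^sup>2) / (N \<tau>)\<^sup>2 / (2*pi)))"
        by (intro continuous_on_mult continuous_on_comp cN continuous_intros)
          (use N0 N1 in \<open>auto simp: less_imp_le\<close>)
      ultimately show "(\<lambda>\<tau>. \<omega> (N \<tau>) * poisson_kernel (of_real r) (cis \<tau>)) integrable_on {0..2*pi}"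
        by (simp add: integrable_continuous_real)
      show "(\<lambda>\<tau>. d / pi * (g (\<tau> / pi) + g (2 - \<tau> / pi))) integrable_on {0..2*pi}"
        by (intro integrable_continuous_real continuous_intros continuous_on_compose2[OF cg[of UNIV]]) auto
      fix \<tau> assume \<tau>: "\<tau> \<in> {0..2*pi}"
      have "1 - r\<^sup>2 = d * (1 + r)" by (simp add: d_def power2_eq_square algebra_simps)
      also have "\<dots> \<le> d * 2" using d r by (intro mult_left_mono) auto
      finally have "(1 - r\<^sup>2) / (2*pi) \<le> (d * 2) / (2*pi)" by (rule divide_right_mono) simp
      then have "(1 - r\<^sup>2) / (2*pi) \<le> d / pi" by simp
      then have "(1 - r\<^sup>2) / (2*pi) * (\<omega> (N \<tau>) / (N \<tau>)\<^sup>2) \<le> d / pi * (g (\<tau> / pi) + g (2 - \<tau> / pi))"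
        using Ng[OF \<tau>] d nonneg[of "N \<tau>"] N0[of \<tau>] by (intro mult_mono) auto
      then show "\<omega> (N \<tau>) * poisson_kernel (of_real r) (cis \<tau>) \<le> d / pi * (g (\<tau> / pi) + g (2 - \<tau> / pi))"
        by (simp add: poisson_kernel_def N_def mult_ac)
    qed
    also have "\<dots> = d / pi * (pi * integral {0..2} g + pi * integral {0..2} g)"
      by (intro integral_unique has_integral_mult_right has_integral_add has_integral_rescale_period gI)
    also have "\<dots> = 2 * d * integral {0..2} g" by simp
    also have "\<dots> \<le> 2 * d * ((1 + C) * \<omega> d / d)" using I d by (intro mult_left_mono) auto
    also have "\<dots> = 2 * (1 + C) * \<omega> d" using d by simp
    finally show ?thesis by (simp add: N_def d_def)
  qed
  then show ?thesis using that[of "2 * (1 + C)"] C by simp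
qed

lemma continuous_on_Poisson_majorant:
  assumes "z \<in> ball 0 1"
  shows "continuous_on (sphere 0 1) (\<lambda>\<zeta>. \<omega> (norm (\<zeta> - w)) * poisson_kernel z \<zeta>)"
  by (intro continuous_on_mult continuous_on_comp continuous_on_poisson_kernel assms continuous_intros) auto

lemma Poisson_majorant:
  obtains C where "0 < C"
    "\<And>z. z \<in> ball 0 1 \<Longrightarrow>
      integral {0..2*pi} (\<lambda>\<tau>. \<omega> (norm (cis \<tau> - z)) * poisson_kernel z (cis \<tau>)) \<le> C * \<omega> (1 - norm z)"
proof -
  obtain C where C: "0 < C" and
    real: "\<And>r. 0 \<le> r \<Longrightarrow> r < 1 \<Longrightarrow>
      integral {0..2*pi} (\<lambda>\<tau>. \<omega> (norm (cis \<tau> - of_real r)) * poisson_kernel (of_real r) (cis \<tau>)) \<le> C * \<omega> (1 - r)"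
    by (rule Poisson_majorant_real) blast
  have "integral {0..2*pi} (\<lambda>\<tau>. \<omega> (norm (cis \<tau> - z)) * poisson_kernel z (cis \<tau>)) \<le> C * \<omega> (1 - norm z)"
    if z: "z \<in> ball 0 1" for z
  proof -
    \<comment> \<open>The rotation by \<open>\<theta>\<close> moves \<open>z\<close> to the positive real axis; \<open>Arg2pi\<close> takes its values in \<open>[0, 2\<pi>)\<close>.\<close>
    define \<theta> where "\<theta> = Arg2pi z"
    have \<theta>: "\<theta> \<in> {0..2*pi}" using Arg2pi[of z] by (auto simp: \<theta>_def)
    have zr: "z = of_real (norm z) * cis \<theta>"
      using Arg2pi[of z] by (simp add: \<theta>_def cis_conv_exp is_Arg_def)
    have nr: "norm (cis \<tau> * cis \<theta> - z) = norm (cis \<tau> - of_real (norm z))" for \<tau>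
      by (subst zr) (simp add: norm_mult flip: left_diff_distrib)
    have pr: "poisson_kernel z (cis \<tau> * cis \<theta>) = poisson_kernel (of_real (norm z)) (cis \<tau>)" for \<tau>
      by (subst zr) (rule poisson_kernel_rotate)
    have "integral {0..2*pi} (\<lambda>\<tau>. \<omega> (norm (cis \<tau> - z)) * poisson_kernel z (cis \<tau>))
       = integral {0..2*pi} (\<lambda>\<tau>. \<omega> (norm (cis \<tau> * cis \<theta> - z)) * poisson_kernel z (cis \<tau> * cis \<theta>))"
      by (rule integral_circle_rotate[OF continuous_on_Poisson_majorant[OF z] \<theta>, symmetric])
    also have "\<dots> \<le> C * \<omega> (1 - norm z)"
      unfolding nr pr by (rule real) (use z in auto)
    finally show ?thesis .
  qed
  then show ?thesis using that C by blast
qed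

end

section \<open>Mean Lipschitz conditions in the disk\<close>

text \<open>
  For \<open>p = \<infinity>\<close> the left-hand side has no rotation, but the set \<open>S\<close> is invariant under rotations and the
  bound only depends on the distance.
\<close>

lemma (in regularity) mean_osc_le_iff:
  assumes p: "1 \<le> p" and F: "continuous_on (cball 0 1) F"
    and S: "S \<subseteq> cball 0 1" "\<And>z \<eta>. z \<in> S \<Longrightarrow> cis \<eta> * z \<in> S" and M: "0 \<le> M"
  shows "(\<forall>z\<^sub>1\<in>S. \<forall>z\<^sub>2\<in>S. mean_osc p F z\<^sub>1 z\<^sub>2 \<le> ennreal (M * \<omega> (norm (z\<^sub>1 - z\<^sub>2)))) \<longleftrightarrow>
    (\<forall>z\<^sub>1\<in>S. \<forall>z\<^sub>2\<in>S. angular_le p (\<lambda>\<eta>. norm (F (cis \<eta> * z\<^sub>1) - F (cis \<eta> * z\<^sub>2))) (M * \<omega> (norm (z\<^sub>1 - z\<^sub>2))))"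
    (is "?L \<longleftrightarrow> ?R")
proof (cases "p = \<infinity>")
  case True
  show ?thesis
  proof
    assume L: ?L
    have "norm (F (cis \<eta> * z\<^sub>1) - F (cis \<eta> * z\<^sub>2)) \<le> M * \<omega> (norm (z\<^sub>1 - z\<^sub>2))"
      if "z\<^sub>1 \<in> S" "z\<^sub>2 \<in> S" for z\<^sub>1 z\<^sub>2 \<eta>
    proof -
      have "norm (cis \<eta> * z\<^sub>1 - cis \<eta> * z\<^sub>2) = norm (z\<^sub>1 - z\<^sub>2)"
        by (simp add: norm_mult flip: right_diff_distrib)
      then show ?thesis
        using L S(2)[OF that(1), of \<eta>] S(2)[OF that(2), of \<eta>] True M nonneg
        by (fastforce simp: mean_osc_def)
    qed
    then show ?R using True by (simp add: angular_le_def)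
  next
    assume R: ?R
    show ?L
    proof (intro ballI)
      fix z\<^sub>1 z\<^sub>2 assume "z\<^sub>1 \<in> S" "z\<^sub>2 \<in> S"
      then have "\<forall>\<eta>\<in>{0..2*pi}. norm (F (cis \<eta> * z\<^sub>1) - F (cis \<eta> * z\<^sub>2)) \<le> M * \<omega> (norm (z\<^sub>1 - z\<^sub>2))"
        using R True by (simp add: angular_le_def)
      from bspec[OF this, of 0] show "mean_osc p F z\<^sub>1 z\<^sub>2 \<le> ennreal (M * \<omega> (norm (z\<^sub>1 - z\<^sub>2)))"
        using True by (simp add: mean_osc_def ennreal_leI)
    qed
  qed
next
  case False
  have "continuous_on {0..2*pi} (\<lambda>\<eta>. F (cis \<eta> * z))" if "z \<in> S" for z
    using that S by (intro continuous_on_compose2[OF F] continuous_intros) (auto simp: norm_mult)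
  then show ?thesis
    using False M nonneg enn2real_ge_1[OF p False]
    by (simp add: mean_osc_def angular_le_def angular_norm_le_iff continuous_intros)
qed

locale regular_disk_algebra_function = disk_algebra_function f + regularity \<omega>
  for f :: "complex \<Rightarrow> complex" and \<omega> :: "real \<Rightarrow> real" +
  fixes p :: ennreal
  assumes p: "1 \<le> p"
begin

abbreviation osc :: "complex \<Rightarrow> complex \<Rightarrow> real \<Rightarrow> real" where
  "osc z w \<equiv> \<lambda>\<eta>. norm (f (cis \<eta> * z) - f (cis \<eta> * w))"

text \<open>
  The excess of the harmonic majorant of \<open>|f|\<close> over the subharmonic function \<open>|f|\<close>, along a circle.
\<close>

abbreviation defect :: "complex \<Rightarrow> real \<Rightarrow> real" where
  "defect z \<equiv> \<lambda>\<eta>. Poisson_integral (\<lambda>\<zeta>. norm (f \<zeta>)) (z * cis \<eta>) - norm (f (z * cis \<eta>))"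

lemma continuous_on_f:
  assumes "continuous_on S w" "\<And>x. x \<in> S \<Longrightarrow> norm (w x) \<le> 1"
  shows "continuous_on S (\<lambda>x. f (w x))"
  by (rule continuous_on_compose2[OF cont assms(1)]) (use assms(2) in auto)

lemma continuous_on_osc:
  assumes "z \<in> cball 0 1" "w \<in> cball 0 1"
  shows "continuous_on S (osc z w)"
  using assms by (intro continuous_intros continuous_on_f) (auto simp: norm_mult)

lemma continuous_on_integrand:
  assumes "z \<in> ball 0 1" "continuous_on ({0..2*pi} \<times> {0..2*pi}) (\<lambda>(\<tau>, \<eta>). g \<tau> \<eta>)"
  shows "continuous_on ({0..2*pi} \<times> {0..2*pi}) (\<lambda>(\<tau>, \<eta>). g \<tau> \<eta> * poisson_kernel z (cis \<tau>))"
  using assms(2) unfolding case_prod_unfold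
  by (intro continuous_on_mult continuous_on_poisson_kernel_cis assms(1)) (auto intro: continuous_intros)

lemma Poisson_integral_norm_rotate:
  assumes z: "z \<in> ball 0 1" and \<eta>: "\<eta> \<in> {0..2*pi}"
  shows "Poisson_integral (\<lambda>\<zeta>. norm (f \<zeta>)) (z * cis \<eta>)
    = integral {0..2*pi} (\<lambda>\<tau>. norm (f (cis \<eta> * cis \<tau>)) * poisson_kernel z (cis \<tau>))"
  using Poisson_integral_rotate[OF continuous_on_norm_sphere z \<eta>] by (simp add: mult.commute)

lemma continuous_on_defect:
  assumes z: "z \<in> ball 0 1"
  shows "continuous_on {0..2*pi} (defect z)"
proof -
  have "continuous_on {0..2*pi} (\<lambda>\<eta>. integral {0..2*pi} (\<lambda>\<tau>. norm (f (cis \<eta> * cis \<tau>)) * poisson_kernel z (cis \<tau>)))"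
    by (intro continuous_on_integral_parameter continuous_on_integrand z)
      (auto simp: case_prod_unfold norm_mult intro!: continuous_intros continuous_on_f)
  then have "continuous_on {0..2*pi} (\<lambda>\<eta>. Poisson_integral (\<lambda>\<zeta>. norm (f \<zeta>)) (z * cis \<eta>))"
    by (rule continuous_on_eq) (simp add: Poisson_integral_norm_rotate[OF z])
  then show ?thesis
    using z by (intro continuous_on_diff continuous_on_norm continuous_on_f continuous_intros)
      (auto simp: norm_mult)
qed

lemma poisson_rotated:
  assumes z: "z \<in> ball 0 1" and \<eta>: "\<eta> \<in> {0..2*pi}"
  shows "((\<lambda>\<tau>. f (cis \<eta> * cis \<tau>) * of_real (poisson_kernel z (cis \<tau>))) has_integral f (z * cis \<eta>)) {0..2*pi}"
proof -
  have "disk_algebra_function (\<lambda>u. f (cis \<eta> * u))"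
  proof
    show "(\<lambda>u. f (cis \<eta> * u)) holomorphic_on ball 0 1"
      by (rule holomorphic_on_compose_gen[of "\<lambda>u. cis \<eta> * u" "ball 0 1" f "ball 0 1", unfolded o_def])
        (use holo in \<open>auto simp: norm_mult intro!: holomorphic_intros\<close>)
    show "continuous_on (cball 0 1) (\<lambda>u. f (cis \<eta> * u))"
      by (intro continuous_on_f continuous_intros) (auto simp: norm_mult)
  qed
  from disk_algebra_function.poisson_representation[OF this z] show ?thesis
    by (simp add: mult.commute)
qed

text \<open>
  Poisson's formula for \<open>f\<close> gives the first part; the second one compares \<open>|f|\<close> on the circle with the
  constant \<open>|f(z)|\<close>, whose Poisson integral is itself.
\<close>

lemma defect_nonneg_le:
  assumes z: "z \<in> ball 0 1" and \<eta>: "\<eta> \<in> {0..2*pi}"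
  shows "0 \<le> defect z \<eta>"
    and "defect z \<eta> \<le> integral {0..2*pi} (\<lambda>\<tau>. osc (cis \<tau>) z \<eta> * poisson_kernel z (cis \<tau>))"
proof -
  let ?K = "\<lambda>\<tau>. poisson_kernel z (cis \<tau>)"
  have K: "continuous_on {0..2*pi} ?K"
    by (rule continuous_on_poisson_kernel_cis[OF _ z]) (auto intro: continuous_intros)
  have cf: "continuous_on {0..2*pi} (\<lambda>\<tau>. f (cis \<eta> * cis \<tau>))"
    by (intro continuous_on_f continuous_intros) (auto simp: norm_mult)
  note R = Poisson_integral_norm_rotate[OF z \<eta>]
  have i1: "(\<lambda>\<tau>. norm (f (cis \<eta> * cis \<tau>)) * ?K \<tau>) integrable_on {0..2*pi}"
    by (intro integrable_continuous_real continuous_intros K cf)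
  have "norm (integral {0..2*pi} (\<lambda>\<tau>. f (cis \<eta> * cis \<tau>) * of_real (?K \<tau>)))
      \<le> integral {0..2*pi} (\<lambda>\<tau>. norm (f (cis \<eta> * cis \<tau>)) * ?K \<tau>)"
    by (rule integral_norm_bound_integral)
      (use poisson_rotated[OF z \<eta>] i1 poisson_kernel_nonneg[OF z] in \<open>auto simp: norm_mult\<close>)
  then show "0 \<le> defect z \<eta>"
    unfolding R integral_unique[OF poisson_rotated[OF z \<eta>]] by simp
  have "((\<lambda>\<tau>. norm (f (cis \<eta> * cis \<tau>)) * ?K \<tau> - norm (f (z * cis \<eta>)) * ?K \<tau>) has_integral
      Poisson_integral (\<lambda>\<zeta>. norm (f \<zeta>)) (z * cis \<eta>) - norm (f (z * cis \<eta>)) * 1) {0..2*pi}"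
    unfolding R
    by (intro has_integral_diff has_integral_mult_right poisson_kernel_has_integral z integrable_integral i1)
  moreover have "((\<lambda>\<tau>. osc (cis \<tau>) z \<eta> * ?K \<tau>) has_integral
      integral {0..2*pi} (\<lambda>\<tau>. osc (cis \<tau>) z \<eta> * ?K \<tau>)) {0..2*pi}"
    by (intro integrable_integral integrable_continuous_real continuous_intros K cf)
  ultimately have "Poisson_integral (\<lambda>\<zeta>. norm (f \<zeta>)) (z * cis \<eta>) - norm (f (z * cis \<eta>)) * 1
      \<le> integral {0..2*pi} (\<lambda>\<tau>. osc (cis \<tau>) z \<eta> * ?K \<tau>)"
  proof (rule has_integral_le)
    fix \<tau>
    have "norm (f (cis \<eta> * cis \<tau>)) - norm (f (z * cis \<eta>)) \<le> osc (cis \<tau>) z \<eta>"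
      by (simp add: mult.commute norm_triangle_ineq2)
    from mult_right_mono[OF this poisson_kernel_nonneg[OF z, of "cis \<tau>"]]
    show "norm (f (cis \<eta> * cis \<tau>)) * ?K \<tau> - norm (f (z * cis \<eta>)) * ?K \<tau> \<le> osc (cis \<tau>) z \<eta> * ?K \<tau>"
      by (simp add: algebra_simps)
  qed
  then show "defect z \<eta> \<le> integral {0..2*pi} (\<lambda>\<tau>. osc (cis \<tau>) z \<eta> * ?K \<tau>)" by simp
qed

text \<open>
  Minkowski's inequality for the average with respect to the Poisson kernel, whose weight \<open>\<omega>(|\<zeta> - w|)\<close>
  is the given bound for the angular norm over the boundary point \<open>\<zeta>\<close>.
\<close>

lemma angular_le_Poisson_average:
  assumes z: "z \<in> ball 0 1"
    and g: "continuous_on ({0..2*pi} \<times> {0..2*pi}) (\<lambda>(\<tau>, \<eta>). g \<tau> \<eta>)"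
      "\<And>\<tau> \<eta>. \<tau> \<in> {0..2*pi} \<Longrightarrow> \<eta> \<in> {0..2*pi} \<Longrightarrow> 0 \<le> g \<tau> \<eta>"
    and M: "0 \<le> M"
    and le: "\<And>\<tau>. \<tau> \<in> {0..2*pi} \<Longrightarrow> angular_le p (g \<tau>) (M * \<omega> (norm (cis \<tau> - w)))"
  shows "angular_le p (\<lambda>\<eta>. integral {0..2*pi} (\<lambda>\<tau>. g \<tau> \<eta> * poisson_kernel z (cis \<tau>)))
    (M * integral {0..2*pi} (\<lambda>\<tau>. \<omega> (norm (cis \<tau> - w)) * poisson_kernel z (cis \<tau>)))"
proof -
  have "angular_le p (\<lambda>\<eta>. integral {0..2*pi} (\<lambda>\<tau>. g \<tau> \<eta> * poisson_kernel z (cis \<tau>)))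
    (integral {0..2*pi} (\<lambda>\<tau>. M * \<omega> (norm (cis \<tau> - w)) * poisson_kernel z (cis \<tau>)))"
  proof (rule angular_le_integral[OF p continuous_on_integrand[OF z g(1)]])
    show "continuous_on {0..2*pi} (\<lambda>\<tau>. M * \<omega> (norm (cis \<tau> - w)) * poisson_kernel z (cis \<tau>))"
      by (intro continuous_on_mult continuous_on_comp continuous_on_poisson_kernel_cis z continuous_intros) auto
    show "angular_le p (\<lambda>\<eta>. g \<tau> \<eta> * poisson_kernel z (cis \<tau>)) (M * \<omega> (norm (cis \<tau> - w)) * poisson_kernel z (cis \<tau>))"
      if \<tau>: "\<tau> \<in> {0..2*pi}" for \<tau>
      using angular_le_cmult[OF p g(2)[OF \<tau>] poisson_kernel_nonneg[OF z, of "cis \<tau>"] _ le[OF \<tau>]] M nonneg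
      by (simp add: mult.commute)
  qed (use g(2) M nonneg poisson_kernel_nonneg[OF z] in auto)
  then show ?thesis by (simp add: mult.assoc)
qed

text \<open>
  Approach \<open>\<zeta>\<close> along its radius.
\<close>

lemma osc_boundary:
  assumes osc: "\<And>z w. z \<in> ball 0 1 \<Longrightarrow> w \<in> ball 0 1 \<Longrightarrow> angular_le p (osc z w) (M * \<omega> (norm (z - w)))"
    and M: "0 \<le> M" and z: "\<zeta> \<in> sphere 0 1" "z \<in> ball 0 1"
  shows "angular_le p (osc \<zeta> z) (M * \<omega> (norm (\<zeta> - z)))"
proof -
  have "angular_le p (osc (of_real 1 * \<zeta>) z) (M * \<omega> (norm (of_real 1 * \<zeta> - z)))"
  proof (rule angular_le_limit[OF p, where h = "\<lambda>r. osc (of_real r * \<zeta>) z"])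
    show "continuous_on ({0..1} \<times> {0..2*pi}) (\<lambda>(r, \<eta>). osc (of_real r * \<zeta>) z \<eta>)"
      unfolding case_prod_unfold
      by (intro continuous_intros continuous_on_f) (use z in \<open>auto simp: norm_mult\<close>)
    show "continuous_on {0..1} (\<lambda>r. M * \<omega> (norm (of_real r * \<zeta> - z)))"
      by (intro continuous_on_mult continuous_on_comp continuous_intros) auto
    show "angular_le p (osc (of_real r * \<zeta>) z) (M * \<omega> (norm (of_real r * \<zeta> - z)))" if "0 \<le> r" "r < 1" for r
      by (rule osc) (use that z in \<open>auto simp: norm_mult\<close>)
  qed (use M nonneg in auto)
  then show ?thesis by simp
qed

lemma defect_le:
  assumes osc: "\<And>z w. z \<in> ball 0 1 \<Longrightarrow> w \<in> ball 0 1 \<Longrightarrow> angular_le p (osc z w) (M * \<omega> (norm (z - w)))"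
    and M: "0 < M"
  obtains M' where "0 < M'" "\<And>z. z \<in> ball 0 1 \<Longrightarrow> angular_le p (defect z) (M' * \<omega> (1 - norm z))"
proof -
  obtain C where C: "0 < C" and
    PC: "\<And>z. z \<in> ball 0 1 \<Longrightarrow>
      integral {0..2*pi} (\<lambda>\<tau>. \<omega> (norm (cis \<tau> - z)) * poisson_kernel z (cis \<tau>)) \<le> C * \<omega> (1 - norm z)"
    by (rule Poisson_majorant) blast
  have "angular_le p (defect z) (M * C * \<omega> (1 - norm z))" if z: "z \<in> ball 0 1" for z
  proof -
    have c: "continuous_on ({0..2*pi} \<times> {0..2*pi}) (\<lambda>(\<tau>, \<eta>). osc (cis \<tau>) z \<eta>)"
      unfolding case_prod_unfold
      by (intro continuous_intros continuous_on_f) (use z in \<open>auto simp: norm_mult\<close>)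
    let ?I = "integral {0..2*pi} (\<lambda>\<tau>. \<omega> (norm (cis \<tau> - z)) * poisson_kernel z (cis \<tau>))"
    have "angular_le p (\<lambda>\<eta>. integral {0..2*pi} (\<lambda>\<tau>. osc (cis \<tau>) z \<eta> * poisson_kernel z (cis \<tau>))) (M * ?I)"
      by (rule angular_le_Poisson_average[OF z c]) (use M osc_boundary[OF osc _ _ z] in auto)
    then show ?thesis
    proof (rule angular_le_mono[OF p, rotated -1])
      show "continuous_on {0..2*pi} (defect z)" by (rule continuous_on_defect[OF z])
      show "continuous_on {0..2*pi} (\<lambda>\<eta>. integral {0..2*pi} (\<lambda>\<tau>. osc (cis \<tau>) z \<eta> * poisson_kernel z (cis \<tau>)))"
        by (intro continuous_on_integral_parameter continuous_on_integrand z c)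
      have "0 \<le> ?I"
        by (rule Henstock_Kurzweil_Integration.integral_nonneg)
          (use z in \<open>auto intro!: integrable_continuous_real continuous_on_mult continuous_on_comp
            continuous_on_poisson_kernel_cis continuous_intros mult_nonneg_nonneg nonneg poisson_kernel_nonneg\<close>)
      then show "0 \<le> M * ?I" using M by simp
      show "M * ?I \<le> M * C * \<omega> (1 - norm z)" using PC[OF z] M by (simp add: mult.assoc)
    qed (use defect_nonneg_le[OF z] in auto)
  qed
  then show ?thesis using that[of "M * C"] M C by simp
qed

lemma continuous_on_deriv:
  assumes "continuous_on S w" "\<And>x. x \<in> S \<Longrightarrow> norm (w x) < 1"
  shows "continuous_on S (\<lambda>x. deriv f (w x))"
  by (rule continuous_on_compose2[OF holomorphic_on_imp_continuous_on[OF holomorphic_deriv[OF holo]] assms(1)])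
    (use assms(2) in auto)

text \<open>
  The pointwise bound for the derivative is used at \<open>z cis \<eta>\<close> with \<open>a = |f(\<zeta> cis \<eta>)|\<close>, where \<open>\<zeta>\<close> is the
  point of the circle nearest to \<open>z\<close>.  Then \<open>|\<xi> - \<zeta>| \<le> 2 |\<xi> - z|\<close> for all \<open>\<xi>\<close> on the circle, so that
  replacing \<open>z\<close> by \<open>\<zeta>\<close> in the Poisson average of the majorant costs a factor \<open>2\<close>.
\<close>

lemma deriv_angular_le:
  assumes bd: "\<And>\<zeta>\<^sub>1 \<zeta>\<^sub>2. \<zeta>\<^sub>1 \<in> sphere 0 1 \<Longrightarrow> \<zeta>\<^sub>2 \<in> sphere 0 1 \<Longrightarrow>
      angular_le p (\<lambda>\<eta>. \<bar>norm (f (cis \<eta> * \<zeta>\<^sub>1)) - norm (f (cis \<eta> * \<zeta>\<^sub>2))\<bar>) (M * \<omega> (norm (\<zeta>\<^sub>1 - \<zeta>\<^sub>2)))"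
    and df: "\<And>z. z \<in> ball 0 1 \<Longrightarrow> angular_le p (defect z) (M' * \<omega> (1 - norm z))"
    and M: "0 < M" "0 < M'"
  obtains C where "0 < C"
    "\<And>z. z \<in> ball 0 1 \<Longrightarrow> angular_le p (\<lambda>\<eta>. norm (deriv f (cis \<eta> * z))) (C * (\<omega> (1 - norm z) / (1 - norm z)))"
proof -
  obtain C where C: "0 < C" and
    PC: "\<And>z. z \<in> ball 0 1 \<Longrightarrow>
      integral {0..2*pi} (\<lambda>\<tau>. \<omega> (norm (cis \<tau> - z)) * poisson_kernel z (cis \<tau>)) \<le> C * \<omega> (1 - norm z)"
    by (rule Poisson_majorant) blast
  define B where "B = 2 * M * C + M'"
  have B: "0 < B" "2 * M * C \<le> B" "M' \<le> B" using M C by (auto simp: B_def add_pos_pos)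
  have "angular_le p (\<lambda>\<eta>. norm (deriv f (cis \<eta> * z))) (8 * B * (\<omega> (1 - norm z) / (1 - norm z)))"
    if z: "z \<in> ball 0 1" for z
  proof -
    define d where "d = 1 - norm z"
    have d: "0 < d" using z by (simp add: d_def)
    \<comment> \<open>For \<open>z = 0\<close> any \<open>\<theta>\<close> will do.\<close>
    obtain \<theta> where zr: "z = of_real (norm z) * cis \<theta>"
      by (metis rcis_cmod_Arg rcis_def)
    define \<zeta> where "\<zeta> = cis \<theta>"
    have \<zeta>: "norm \<zeta> = 1" by (simp add: \<zeta>_def)
    have "norm (z - \<zeta>) = norm (complex_of_real (norm z - 1) * cis \<theta>)"
      by (subst zr) (simp add: \<zeta>_def algebra_simps)
    also have "\<dots> = d" using z by (simp only: norm_mult norm_cis norm_of_real) (simp add: d_def)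
    finally have z\<zeta>: "norm (z - \<zeta>) = d" .
    define g where "g = (\<lambda>\<tau> \<eta>. \<bar>norm (f (cis \<eta> * cis \<tau>)) - norm (f (cis \<eta> * \<zeta>))\<bar>)"
    define G where "G = (\<lambda>\<eta>. integral {0..2*pi} (\<lambda>\<tau>. g \<tau> \<eta> * poisson_kernel z (cis \<tau>)))"
    have g: "continuous_on ({0..2*pi} \<times> {0..2*pi}) (\<lambda>(\<tau>, \<eta>). g \<tau> \<eta>)"
      unfolding case_prod_unfold g_def
      by (intro continuous_intros continuous_on_f) (use \<zeta> in \<open>auto simp: norm_mult\<close>)
    have cG: "continuous_on {0..2*pi} G"
      unfolding G_def by (intro continuous_on_integral_parameter continuous_on_integrand z g)
    have G0: "0 \<le> G \<eta>" if "\<eta> \<in> {0..2*pi}" for \<eta>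
      unfolding G_def
      by (intro Henstock_Kurzweil_Integration.integral_nonneg integrable_continuous_real
          continuous_on_slice[OF continuous_on_integrand[OF z g] that] mult_nonneg_nonneg poisson_kernel_nonneg z)
        (simp add: g_def)
    let ?I = "\<lambda>w. integral {0..2*pi} (\<lambda>\<tau>. \<omega> (norm (cis \<tau> - w)) * poisson_kernel z (cis \<tau>))"
    have ci: "(\<lambda>\<tau>. \<omega> (norm (cis \<tau> - w)) * poisson_kernel z (cis \<tau>)) integrable_on {0..2*pi}" for w
      by (intro integrable_continuous_real continuous_on_mult continuous_on_comp
          continuous_on_poisson_kernel_cis z continuous_intros) auto
    have "?I \<zeta> \<le> integral {0..2*pi} (\<lambda>\<tau>. 2 * (\<omega> (norm (cis \<tau> - z)) * poisson_kernel z (cis \<tau>)))"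
    proof (rule integral_le)
      fix \<tau>
      have "norm (cis \<tau> - \<zeta>) \<le> norm (cis \<tau> - z) + d"
        using norm_triangle_ineq[of "cis \<tau> - z" "z - \<zeta>"] z\<zeta> by simp
      moreover have "d \<le> norm (cis \<tau> - z)"
        using norm_triangle_ineq2[of "cis \<tau>" z] by (simp add: d_def)
      ultimately have "\<omega> (norm (cis \<tau> - \<zeta>)) \<le> \<omega> (2 * norm (cis \<tau> - z))"
        by (intro mono) auto
      also have "\<dots> \<le> 2 * \<omega> (norm (cis \<tau> - z))" by (rule scale) auto
      finally have "\<omega> (norm (cis \<tau> - \<zeta>)) \<le> 2 * \<omega> (norm (cis \<tau> - z))" .
      from mult_right_mono[OF this poisson_kernel_nonneg[OF z, of "cis \<tau>"]]
      show "\<omega> (norm (cis \<tau> - \<zeta>)) * poisson_kernel z (cis \<tau>)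
          \<le> 2 * (\<omega> (norm (cis \<tau> - z)) * poisson_kernel z (cis \<tau>))" by simp
    qed (auto intro: ci integrable_on_mult_right)
    also have "\<dots> = 2 * ?I z" by simp
    also have "\<dots> \<le> 2 * (C * \<omega> d)" using PC[OF z] by (simp add: d_def)
    finally have I: "?I \<zeta> \<le> 2 * (C * \<omega> d)" .
    have I0: "0 \<le> ?I \<zeta>"
      by (rule Henstock_Kurzweil_Integration.integral_nonneg[OF ci])
        (auto intro!: mult_nonneg_nonneg nonneg poisson_kernel_nonneg z)
    have \<omega>d: "0 \<le> \<omega> d" using d by (simp add: nonneg)
    have "angular_le p G (M * ?I \<zeta>)"
      unfolding G_def
      by (rule angular_le_Poisson_average[OF z g]) (use bd M \<zeta> in \<open>auto simp: g_def\<close>)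
    then have GB: "angular_le p G (B * \<omega> d)"
    proof (rule angular_le_mono[OF p cG cG, rotated -1])
      show "0 \<le> M * ?I \<zeta>" using M I0 by simp
      have "M * ?I \<zeta> \<le> M * (2 * (C * \<omega> d))" using I M by simp
      also have "\<dots> \<le> B * \<omega> d" using mult_right_mono[OF B(2) \<omega>d] by (simp add: mult_ac)
      finally show "M * ?I \<zeta> \<le> B * \<omega> d" .
    qed (use G0 in auto)
    have DB: "angular_le p (defect z) (B * \<omega> d)"
      using df[OF z] unfolding d_def[symmetric]
      by (rule angular_le_mono[OF p continuous_on_defect[OF z] continuous_on_defect[OF z], rotated -1])
        (use defect_nonneg_le[OF z] B M \<omega>d in \<open>auto intro: mult_right_mono\<close>)
    have cs: "continuous_on {0..2*pi} (\<lambda>\<eta>. G \<eta> + defect z \<eta>)"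
      by (intro continuous_on_add cG continuous_on_defect z)
    have s0: "0 \<le> G \<eta> + defect z \<eta>" if "\<eta> \<in> {0..2*pi}" for \<eta>
      using G0[OF that] defect_nonneg_le(1)[OF z that] by linarith
    have "angular_le p (\<lambda>\<eta>. G \<eta> + defect z \<eta>) (4 * (B * \<omega> d))"
      by (rule angular_le_add[OF p cG G0 continuous_on_defect[OF z] defect_nonneg_le(1)[OF z] _ GB DB])
        (use B \<omega>d in auto)
    then have "angular_le p (\<lambda>\<eta>. 2 / d * (G \<eta> + defect z \<eta>)) (2 / d * (4 * (B * \<omega> d)))"
      by (intro angular_le_cmult[OF p s0]) (use d B \<omega>d in auto)
    then show ?thesis
    proof (rule angular_le_mono[OF p, rotated -1])
      show "continuous_on {0..2*pi} (\<lambda>\<eta>. norm (deriv f (cis \<eta> * z)))"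
        by (intro continuous_intros continuous_on_deriv) (use z in \<open>auto simp: norm_mult\<close>)
      show "continuous_on {0..2*pi} (\<lambda>\<eta>. 2 / d * (G \<eta> + defect z \<eta>))"
        by (intro continuous_on_mult cs continuous_intros)
      fix \<eta> assume \<eta>: "\<eta> \<in> {0..2*pi}"
      let ?a = "norm (f (cis \<eta> * \<zeta>))"
      have z': "z * cis \<eta> \<in> ball 0 1" using z by (simp add: norm_mult)
      have ca: "continuous_on (sphere 0 1) (\<lambda>\<xi>. \<bar>norm (f \<xi>) - ?a\<bar>)"
        by (intro continuous_intros continuous_on_norm_sphere)
      have "integral {0..2*pi} (\<lambda>\<tau>. \<bar>norm (f (cis \<tau>)) - ?a\<bar> * poisson_kernel (z * cis \<eta>) (cis \<tau>)) = G \<eta>"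
        using Poisson_integral_eq[OF ca z'] Poisson_integral_rotate[OF ca z \<eta>]
        by (simp add: G_def g_def mult.commute)
      then have "(1 - (norm z)\<^sup>2) * norm (deriv f (z * cis \<eta>)) \<le> 2 * (G \<eta> + defect z \<eta>)"
        using deriv_le_Poisson[OF z', of ?a] by (simp add: norm_mult algebra_simps)
      moreover have "d * norm (deriv f (z * cis \<eta>)) \<le> (1 - (norm z)\<^sup>2) * norm (deriv f (z * cis \<eta>))"
      proof (rule mult_right_mono)
        have "(norm z)\<^sup>2 \<le> norm z" using z by (simp add: power2_eq_square mult_left_le)
        then show "d \<le> 1 - (norm z)\<^sup>2" by (simp add: d_def)
      qed simp
      ultimately have "norm (deriv f (z * cis \<eta>)) \<le> 2 / d * (G \<eta> + defect z \<eta>)"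
        using d by (simp add: field_simps)
      then show "0 \<le> norm (deriv f (cis \<eta> * z)) \<and> norm (deriv f (cis \<eta> * z)) \<le> 2 / d * (G \<eta> + defect z \<eta>)"
        by (simp add: mult.commute)
    qed (use d B \<omega>d in \<open>auto simp: d_def\<close>)
  qed
  then show ?thesis using that[of "8 * B"] B by simp
qed

text \<open>
  Integrate the derivative along the segment and apply Minkowski's inequality.
\<close>

lemma osc_le_along_line:
  fixes a v :: complex and l u :: real
  assumes D: "\<And>s. s \<in> {l..u} \<Longrightarrow> angular_le p (\<lambda>\<eta>. norm (deriv f (cis \<eta> * (a + of_real s * v)))) (D s)"
    and ball: "\<And>s. s \<in> {l..u} \<Longrightarrow> a + of_real s * v \<in> ball 0 1" and lu: "l \<le> u"
    and cD: "continuous_on {l..u} D" and D0: "\<And>s. s \<in> {l..u} \<Longrightarrow> 0 \<le> D s"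
  shows "angular_le p (osc (a + of_real u * v) (a + of_real l * v)) (norm v * integral {l..u} D)"
proof -
  define g where "g = (\<lambda>s \<eta>. norm v * norm (deriv f (cis \<eta> * (a + of_real s * v))))"
  have nb: "norm (cis \<eta> * (a + of_real s * v)) < 1" if "s \<in> {l..u}" for s \<eta>
    using ball[OF that] by (simp add: norm_mult)
  have g: "continuous_on ({l..u} \<times> {0..2*pi}) (\<lambda>(s, \<eta>). g s \<eta>)"
    unfolding case_prod_unfold g_def
    by (intro continuous_intros continuous_on_deriv nb) auto
  have "angular_le p (\<lambda>\<eta>. integral {l..u} (\<lambda>s. g s \<eta>)) (integral {l..u} (\<lambda>s. norm v * D s))"
  proof (rule angular_le_integral[OF p g])
    show "angular_le p (g s) (norm v * D s)" if "s \<in> {l..u}" for s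
      unfolding g_def by (rule angular_le_cmult[OF p]) (use D D0 that in auto)
  qed (use cD D0 in \<open>auto simp: g_def intro!: continuous_intros\<close>)
  then show ?thesis
  proof (rule angular_le_mono[OF p, rotated -1])
    show "continuous_on {0..2*pi} (osc (a + of_real u * v) (a + of_real l * v))"
      by (rule continuous_on_osc) (use ball[of u] ball[of l] lu in \<open>auto simp: less_imp_le\<close>)
    show "continuous_on {0..2*pi} (\<lambda>\<eta>. integral {l..u} (\<lambda>s. g s \<eta>))"
      by (rule continuous_on_integral_parameter[OF g])
    show "0 \<le> integral {l..u} (\<lambda>s. norm v * D s)"
      by (intro Henstock_Kurzweil_Integration.integral_nonneg integrable_continuous_real continuous_intros cD)
        (use D0 in auto)
    fix \<eta> assume \<eta>: "\<eta> \<in> {0..2*pi}"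
    have "((\<lambda>s. deriv f (cis \<eta> * (a + of_real s * v)) * (cis \<eta> * v)) has_integral
        f (cis \<eta> * (a + of_real u * v)) - f (cis \<eta> * (a + of_real l * v))) {l..u}"
    proof (rule fundamental_theorem_of_calculus[OF lu])
      fix s assume s: "s \<in> {l..u}"
      have "(f has_field_derivative deriv f (cis \<eta> * (a + of_real s * v))) (at (cis \<eta> * (a + of_real s * v)))"
        by (rule holomorphic_derivI[OF holo]) (use nb[OF s] in auto)
      note F = has_field_derivative_at_within[OF this]
      have V: "((\<lambda>s. cis \<eta> * (a + of_real s * v)) has_vector_derivative cis \<eta> * v) (at s within {l..u})"
        by (auto intro!: derivative_eq_intros)
      show "((\<lambda>s. f (cis \<eta> * (a + of_real s * v))) has_vector_derivative
          deriv f (cis \<eta> * (a + of_real s * v)) * (cis \<eta> * v)) (at s within {l..u})"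
        using field_vector_diff_chain_within[OF V F] by (simp add: o_def mult_ac)
    qed
    then have "osc (a + of_real u * v) (a + of_real l * v) \<eta> =
        norm (integral {l..u} (\<lambda>s. deriv f (cis \<eta> * (a + of_real s * v)) * (cis \<eta> * v)))"
      by (simp only: integral_unique)
    also have "\<dots> \<le> integral {l..u} (\<lambda>s. g s \<eta>)"
    proof (rule integral_norm_bound_integral)
      show "(\<lambda>s. deriv f (cis \<eta> * (a + of_real s * v)) * (cis \<eta> * v)) integrable_on {l..u}"
        by (intro integrable_continuous_real continuous_intros continuous_on_deriv nb) auto
      show "(\<lambda>s. g s \<eta>) integrable_on {l..u}"
        by (intro integrable_continuous_real continuous_on_slice[OF g \<eta>])
    qed (simp add: g_def norm_mult)
    finally show "0 \<le> osc (a + of_real u * v) (a + of_real l * v) \<eta> \<and>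
        osc (a + of_real u * v) (a + of_real l * v) \<eta> \<le> integral {l..u} (\<lambda>s. g s \<eta>)" by simp
  qed simp
qed

lemma angular_le_zero: "0 \<le> B \<Longrightarrow> angular_le p (\<lambda>\<eta>. 0) B"
  by (simp add: angular_le_def)

text \<open>
  Let \<open>h = min |z - w| 1\<close>, and let \<open>\<pi>\<close> be the radial projection onto the disk of radius \<open>1 - h\<close>.  The
  point \<open>\<pi> z\<close> is reached along a radius, on which the bound \<open>\<omega>(s)/s\<close> at depth \<open>s\<close> has an integral of
  order \<open>\<omega>(h)\<close>.  The segment from \<open>\<pi> z\<close> to \<open>\<pi> w\<close> has length at most \<open>3h\<close> and stays at depth at least \<open>h\<close>,
  where the bound is at most \<open>\<omega>(h)/h\<close>.
\<close>

lemma osc_le: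
  assumes D: "\<And>z. z \<in> ball 0 1 \<Longrightarrow>
      angular_le p (\<lambda>\<eta>. norm (deriv f (cis \<eta> * z))) (C * (\<omega> (1 - norm z) / (1 - norm z)))"
    and C: "0 < C"
  obtains M where "0 < M"
    "\<And>z w. z \<in> ball 0 1 \<Longrightarrow> w \<in> ball 0 1 \<Longrightarrow> angular_le p (osc z w) (M * \<omega> (norm (z - w)))"
proof -
  obtain C' where C': "0 < C'" and
    int: "\<And>\<epsilon> \<delta>. 0 < \<epsilon> \<Longrightarrow> \<epsilon> \<le> \<delta> \<Longrightarrow> \<delta> \<le> 1 \<Longrightarrow> integral {\<epsilon>..\<delta>} (\<lambda>t. \<omega> t / t) \<le> C' * \<omega> \<delta>"
    by (rule integral_ratio_le) blast
  define B where "B = C * C' + 3 * C"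
  have B: "0 < B" "C * C' \<le> B" "3 * C \<le> B" using C C' by (auto simp: B_def add_pos_pos)
  have "angular_le p (osc z w) (16 * B * \<omega> (norm (z - w)))"
    if zw: "z \<in> ball 0 1" "w \<in> ball 0 1" for z w
  proof (cases "z = w")
    case True
    then show ?thesis by (simp add: angular_le_zero zero)
  next
    case False
    define h where "h = min (norm (z - w)) 1"
    have h: "0 < h" "h \<le> 1" "h \<le> norm (z - w)" using False by (auto simp: h_def)
    have \<omega>h: "0 \<le> \<omega> h" using h by (simp add: nonneg)
    define \<pi> where "\<pi> = (\<lambda>z::complex. if 1 - norm z < h then of_real (1 - h) * sgn z else z)"
    have radial: "norm (\<pi> z) \<le> 1 - h" "norm (z - \<pi> z) \<le> h" "angular_le p (osc z (\<pi> z)) (B * \<omega> h)"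
      if z: "z \<in> ball 0 1" for z
    proof -
      have "norm (of_real (1 - h) * sgn z) \<le> 1 - h"
        using h by (simp only: norm_mult norm_of_real norm_sgn) simp
      then show A: "norm (\<pi> z) \<le> 1 - h" by (auto simp: \<pi>_def simp del: of_real_diff)
      show "norm (z - \<pi> z) \<le> h"
      proof (cases "1 - norm z < h")
        case True
        then have "z \<noteq> 0" using h by auto
        then have "z = of_real (norm z) * sgn z" by (simp add: sgn_eq)
        then have "z - \<pi> z = of_real (norm z - (1 - h)) * sgn z"
          using True by (simp add: \<pi>_def algebra_simps)
        then show ?thesis using True z \<open>z \<noteq> 0\<close>
          by (simp only: norm_mult norm_of_real norm_sgn) simp
      qed (use h in \<open>simp add: \<pi>_def\<close>)
      show "angular_le p (osc z (\<pi> z)) (B * \<omega> h)"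
      proof (cases "1 - norm z < h")
        case True
        define e where "e = sgn z"
        define d where "d = 1 - norm z"
        have "z \<noteq> 0" using True h by auto
        then have e: "norm e = 1" and ze: "z = of_real (norm z) * e"
          unfolding e_def by (simp add: norm_sgn, simp add: sgn_eq)
        have d: "0 < d" "d \<le> h" using z True by (auto simp: d_def)
        \<comment> \<open>The parameter \<open>s\<close> on the radius is the distance to the circle.\<close>
        have nrm: "norm (e + of_real s * - e) = 1 - s" if "s \<in> {d..h}" for s
        proof -
          have "e + of_real s * - e = of_real (1 - s) * e" by (simp add: algebra_simps)
          then show ?thesis using that h d e by (simp only: norm_mult norm_of_real) simp
        qed
        have cr: "continuous_on {d..h} (\<lambda>s. C * (\<omega> s / s))"
          by (intro continuous_on_mult continuous_on_const continuous_on_ratio d)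
        have "angular_le p (osc (e + of_real h * - e) (e + of_real d * - e)) (norm (- e) * integral {d..h} (\<lambda>s. C * (\<omega> s / s)))"
        proof (rule osc_le_along_line[OF _ _ d(2) cr])
          show in_ball: "e + of_real s * - e \<in> ball 0 1" if "s \<in> {d..h}" for s
            using nrm[OF that] that d by simp
          show "angular_le p (\<lambda>\<eta>. norm (deriv f (cis \<eta> * (e + of_real s * - e)))) (C * (\<omega> s / s))"
            if "s \<in> {d..h}" for s
            using D[OF in_ball[OF that]] unfolding nrm[OF that] by simp
          show "0 \<le> C * (\<omega> s / s)" if "s \<in> {d..h}" for s
            by (intro mult_nonneg_nonneg ratio_nonneg) (use C d that in auto)
        qed
        moreover have "e + of_real h * - e = \<pi> z" using True by (simp add: \<pi>_def e_def algebra_simps)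
        moreover have "e + of_real d * - e = z"
        proof -
          have "e + of_real d * - e = of_real (norm z) * e" by (simp add: d_def algebra_simps)
          also note ze[symmetric]
          finally show ?thesis .
        qed
        moreover have "integral {d..h} (\<lambda>s. C * (\<omega> s / s)) = C * integral {d..h} (\<lambda>s. \<omega> s / s)"
          by (rule integral_mult_right)
        ultimately have "angular_le p (osc (\<pi> z) z) (C * integral {d..h} (\<lambda>s. \<omega> s / s))"
          by (simp only: norm_minus_cancel e mult_1_left)
        then have *: "angular_le p (osc z (\<pi> z)) (C * integral {d..h} (\<lambda>s. \<omega> s / s))"
          by (simp only: norm_minus_commute)
        have cz: "continuous_on {0..2*pi} (osc z (\<pi> z))"
          by (rule continuous_on_osc) (use z A h in auto)
        from * show ?thesis
        proof (rule angular_le_mono[OF p cz cz, rotated -1])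
          have "0 \<le> integral {d..h} (\<lambda>s. \<omega> s / s)"
            by (intro Henstock_Kurzweil_Integration.integral_nonneg integrable_continuous_real continuous_on_ratio d ratio_nonneg)
              (use d in auto)
          then show "0 \<le> C * integral {d..h} (\<lambda>s. \<omega> s / s)" using C by simp
          have "C * integral {d..h} (\<lambda>s. \<omega> s / s) \<le> C * (C' * \<omega> h)"
            using C int[OF d h(2)] by simp
          also have "\<dots> \<le> B * \<omega> h" using mult_right_mono[OF B(2) \<omega>h] by (simp add: mult.assoc)
          finally show "C * integral {d..h} (\<lambda>s. \<omega> s / s) \<le> B * \<omega> h" .
        qed auto
      qed (use B \<omega>h in \<open>simp add: \<pi>_def angular_le_zero\<close>)
    qed
    have dist: "norm (\<pi> z - \<pi> w) \<le> 3 * h"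
    proof (cases "norm (z - w) \<le> 1")
      case True
      have "norm (\<pi> z - \<pi> w) \<le> norm (z - \<pi> z) + norm (z - w) + norm (w - \<pi> w)"
        by norm
      then show ?thesis using radial(2)[OF zw(1)] radial(2)[OF zw(2)] True by (simp add: h_def)
    next
      case False
      \<comment> \<open>Here \<open>h = 1\<close>, so both points are projected to the centre.\<close>
      then have "\<pi> z = 0" "\<pi> w = 0"
        using radial(1)[OF zw(1)] radial(1)[OF zw(2)] by (auto simp: h_def)
      then show ?thesis using h by simp
    qed
    have line: "\<pi> z + of_real s * (\<pi> w - \<pi> z) \<in> cball 0 (1 - h)" if "s \<in> {0..1}" for s
    proof -
      have "(1 - s) *\<^sub>R \<pi> z + s *\<^sub>R \<pi> w \<in> cball 0 (1 - h)"
        by (rule convexD_alt[OF convex_cball]) (use radial(1) zw that in auto)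
      then show ?thesis by (simp add: scaleR_conv_of_real algebra_simps)
    qed
    have Ch: "0 \<le> C * (\<omega> h / h)"
      by (intro mult_nonneg_nonneg ratio_nonneg h) (use C in simp)
    have "angular_le p (osc (\<pi> z + of_real 1 * (\<pi> w - \<pi> z)) (\<pi> z + of_real 0 * (\<pi> w - \<pi> z)))
       (norm (\<pi> w - \<pi> z) * integral {0..1} (\<lambda>s::real. C * (\<omega> h / h)))"
    proof (rule osc_le_along_line[where D = "\<lambda>_. C * (\<omega> h / h)"])
      fix s :: real assume s: "s \<in> {0..1}"
      let ?y = "\<pi> z + of_real s * (\<pi> w - \<pi> z)"
      have y: "norm ?y \<le> 1 - h" using line[OF s] by simp
      then show yb: "?y \<in> ball 0 1" using h by simp
      show "0 \<le> C * (\<omega> h / h)" by (rule Ch)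
      have c: "continuous_on {0..2*pi} (\<lambda>\<eta>. norm (deriv f (cis \<eta> * ?y)))"
        by (intro continuous_intros continuous_on_deriv) (use yb in \<open>auto simp: norm_mult\<close>)
      from D[OF yb] show "angular_le p (\<lambda>\<eta>. norm (deriv f (cis \<eta> * ?y))) (C * (\<omega> h / h))"
      proof (rule angular_le_mono[OF p c c, rotated -1])
        show "0 \<le> C * (\<omega> (1 - norm ?y) / (1 - norm ?y))"
          by (intro mult_nonneg_nonneg ratio_nonneg) (use C yb in auto)
        show "C * (\<omega> (1 - norm ?y) / (1 - norm ?y)) \<le> C * (\<omega> h / h)"
          using ratio_antimono[OF h(1), of "1 - norm ?y"] y C by (intro mult_left_mono) auto
      qed auto
    qed auto
    then have mid0: "angular_le p (osc (\<pi> w) (\<pi> z)) (norm (\<pi> w - \<pi> z) * (C * (\<omega> h / h)))" by simp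
    have cp: "continuous_on {0..2*pi} (osc (\<pi> w) (\<pi> z))"
      by (rule continuous_on_osc) (use radial(1)[OF zw(1)] radial(1)[OF zw(2)] h in auto)
    from mid0 have mid: "angular_le p (osc (\<pi> w) (\<pi> z)) (B * \<omega> h)"
    proof (rule angular_le_mono[OF p cp cp, rotated -1])
      show "0 \<le> norm (\<pi> w - \<pi> z) * (C * (\<omega> h / h))"
        by (intro mult_nonneg_nonneg Ch norm_ge_zero)
      have "norm (\<pi> w - \<pi> z) * (C * (\<omega> h / h)) \<le> 3 * h * (C * (\<omega> h / h))"
        by (rule mult_right_mono[OF _ Ch]) (use dist in \<open>simp add: norm_minus_commute\<close>)
      also have "\<dots> = 3 * C * \<omega> h" using h by simp
      also have "\<dots> \<le> B * \<omega> h" using B \<omega>h by (intro mult_right_mono) auto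
      finally show "norm (\<pi> w - \<pi> z) * (C * (\<omega> h / h)) \<le> B * \<omega> h" .
    qed auto
    have cz: "continuous_on {0..2*pi} (osc z (\<pi> z))" and cw: "continuous_on {0..2*pi} (osc w (\<pi> w))"
      using radial(1)[OF zw(1)] radial(1)[OF zw(2)] zw h by (auto intro!: continuous_on_osc)
    let ?s = "\<lambda>\<eta>. osc z (\<pi> z) \<eta> + osc w (\<pi> w) \<eta>"
    have cs: "continuous_on {0..2*pi} ?s" by (intro continuous_on_add cz cw)
    have B4: "B * \<omega> h \<le> 4 * (B * \<omega> h)" using B \<omega>h by simp
    have s: "angular_le p ?s (4 * (B * \<omega> h))"
      by (rule angular_le_add[OF p cz _ cw _ _ radial(3)[OF zw(1)] radial(3)[OF zw(2)]]) (use B \<omega>h in auto)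
    have m: "angular_le p (osc (\<pi> w) (\<pi> z)) (4 * (B * \<omega> h))"
      by (rule angular_le_mono[OF p cp cp _ _ B4 mid]) (use B \<omega>h in auto)
    have "angular_le p (\<lambda>\<eta>. ?s \<eta> + osc (\<pi> w) (\<pi> z) \<eta>) (4 * (4 * (B * \<omega> h)))"
      by (rule angular_le_add[OF p cs _ cp _ _ s m]) (use B \<omega>h in auto)
    then show ?thesis
    proof (rule angular_le_mono[OF p, rotated -1])
      show "continuous_on {0..2*pi} (osc z w)" by (rule continuous_on_osc) (use zw in auto)
      show "continuous_on {0..2*pi} (\<lambda>\<eta>. ?s \<eta> + osc (\<pi> w) (\<pi> z) \<eta>)" by (intro continuous_on_add cs cp)
      show "0 \<le> osc z w \<eta> \<and> osc z w \<eta> \<le> ?s \<eta> + osc (\<pi> w) (\<pi> z) \<eta>" for \<eta> by norm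
      show "0 \<le> 4 * (4 * (B * \<omega> h))" using B \<omega>h by simp
      have "B * \<omega> h \<le> B * \<omega> (norm (z - w))" using B h by (intro mult_left_mono mono) auto
      then show "4 * (4 * (B * \<omega> h)) \<le> 16 * B * \<omega> (norm (z - w))" by simp
    qed
  qed
  then show ?thesis using that[of "16 * B"] B by simp
qed

end

theorem corollary2p9:
  fixes p :: ennreal and \<omega> :: "real \<Rightarrow> real" and f :: "complex \<Rightarrow> complex"
  assumes "1 \<le> p"
    and "regular_majorant \<omega>"
    and "f \<in> disk_algebra"
    and "(\<lambda>\<xi>. complex_of_real (norm (f \<xi>))) \<in> Lipschitz_circle \<omega> p"
  shows "f \<in> Lipschitz_disk \<omega> p \<longleftrightarrow>
    (\<exists>M>0. \<forall>z\<in>ball 0 1.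
      if p = \<infinity>
      then Poisson_integral (\<lambda>\<xi>. norm (f \<xi>)) z - norm (f z) \<le> M * \<omega> (dist_bdry z)
      else angular_norm (enn2real p)
             (\<lambda>\<eta>. Poisson_integral (\<lambda>\<xi>. norm (f \<xi>)) (z * cis \<eta>) - norm (f (z * cis \<eta>)))
           \<le> ennreal (M * \<omega> (dist_bdry z)))" (is "_ \<longleftrightarrow> (\<exists>M>0. ?E2 M)")
proof -
  interpret regular_disk_algebra_function f \<omega> p
    using assms(1-3)
    by unfold_locales (auto simp: disk_algebra_def analytic_imp_holomorphic)
  have cn: "continuous_on (cball 0 1) (\<lambda>\<xi>. complex_of_real (norm (f \<xi>)))"
    by (intro continuous_intros cont)
  have rot_sphere: "cis \<eta> * z \<in> sphere 0 1" if "z \<in> sphere 0 1" for z \<eta>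
    using that by (simp add: norm_mult)
  have rot_ball: "cis \<eta> * z \<in> ball 0 1" if "z \<in> ball 0 1" for z \<eta>
    using that by (simp add: norm_mult)
  obtain M where M: "0 < M" and bd0: "\<forall>\<zeta>\<^sub>1\<in>sphere 0 1. \<forall>\<zeta>\<^sub>2\<in>sphere 0 1.
      mean_osc p (\<lambda>\<xi>. complex_of_real (norm (f \<xi>))) \<zeta>\<^sub>1 \<zeta>\<^sub>2 \<le> ennreal (M * \<omega> (norm (\<zeta>\<^sub>1 - \<zeta>\<^sub>2)))"
    using assms(4) by (auto simp: Lipschitz_circle_def)
  have bd: "angular_le p (\<lambda>\<eta>. \<bar>norm (f (cis \<eta> * \<zeta>\<^sub>1)) - norm (f (cis \<eta> * \<zeta>\<^sub>2))\<bar>) (M * \<omega> (norm (\<zeta>\<^sub>1 - \<zeta>\<^sub>2)))"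
    if "\<zeta>\<^sub>1 \<in> sphere 0 1" "\<zeta>\<^sub>2 \<in> sphere 0 1" for \<zeta>\<^sub>1 \<zeta>\<^sub>2
    using bd0 M that
    by (subst (asm) mean_osc_le_iff[OF p cn _ rot_sphere]) (auto simp flip: of_real_diff)
  have meas: "f \<in> borel_measurable (restrict_space borel (ball 0 1))"
    by (intro borel_measurable_continuous_on_restrict continuous_on_subset[OF cont]) auto
  have E1: "f \<in> Lipschitz_disk \<omega> p \<longleftrightarrow>
      (\<exists>M>0. \<forall>z\<in>ball 0 1. \<forall>w\<in>ball 0 1. angular_le p (osc z w) (M * \<omega> (norm (z - w))))"
    using meas mean_osc_le_iff[OF p cont ball_subset_cball rot_ball less_imp_le]
    unfolding Lipschitz_disk_def by blast
  have E2: "?E2 M \<longleftrightarrow> (\<forall>z\<in>ball 0 1. angular_le p (defect z) (M * \<omega> (1 - norm z)))" if M: "0 < M" for M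
  proof (cases "p = \<infinity>")
    case True
    show ?thesis
    proof
      assume L: "?E2 M"
      have "defect z \<eta> \<le> M * \<omega> (1 - norm z)" if "z \<in> ball 0 1" for z \<eta>
        using L[rule_format, of "z * cis \<eta>"] that True by (simp add: norm_mult dist_bdry_def)
      then show "\<forall>z\<in>ball 0 1. angular_le p (defect z) (M * \<omega> (1 - norm z))"
        using True by (simp add: angular_le_def)
    next
      assume R: "\<forall>z\<in>ball 0 1. angular_le p (defect z) (M * \<omega> (1 - norm z))"
      have "defect z 0 \<le> M * \<omega> (1 - norm z)" if "z \<in> ball 0 1" for z
      proof -
        have "\<forall>\<eta>\<in>{0..2*pi}. defect z \<eta> \<le> M * \<omega> (1 - norm z)"
          using R that True by (simp add: angular_le_def)
        from bspec[OF this, of 0] show ?thesis by simp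
      qed
      then show "?E2 M" using True by (simp add: dist_bdry_def)
    qed
  next
    case False
    have "angular_norm (enn2real p) (defect z) \<le> ennreal (M * \<omega> (1 - norm z)) \<longleftrightarrow>
        angular_le p (defect z) (M * \<omega> (1 - norm z))" if z: "z \<in> ball 0 1" for z
      using angular_norm_le_iff[OF enn2real_ge_1[OF p False] continuous_on_defect[OF z] defect_nonneg_le(1)[OF z]]
        M nonneg[of "1 - norm z"] z False
      by (simp add: angular_le_def)
    then show ?thesis using False by (simp add: dist_bdry_def)
  qed
  show ?thesis
  proof
    assume "f \<in> Lipschitz_disk \<omega> p"
    then obtain K where "0 < K"
      "\<And>z w. z \<in> ball 0 1 \<Longrightarrow> w \<in> ball 0 1 \<Longrightarrow> angular_le p (osc z w) (K * \<omega> (norm (z - w)))"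
      unfolding E1 by blast
    then obtain M' where "0 < M'" "\<And>z. z \<in> ball 0 1 \<Longrightarrow> angular_le p (defect z) (M' * \<omega> (1 - norm z))"
      using defect_le by blast
    then show "\<exists>M>0. ?E2 M" using E2 by blast
  next
    assume "\<exists>M>0. ?E2 M"
    then obtain M' where M': "0 < M'" and "?E2 M'" by blast
    then have df: "\<And>z. z \<in> ball 0 1 \<Longrightarrow> angular_le p (defect z) (M' * \<omega> (1 - norm z))"
      using E2[OF M'] by blast
    obtain C where "0 < C" "\<And>z. z \<in> ball 0 1 \<Longrightarrow>
        angular_le p (\<lambda>\<eta>. norm (deriv f (cis \<eta> * z))) (C * (\<omega> (1 - norm z) / (1 - norm z)))"
      using deriv_angular_le[OF bd df M M'] by blast
    then obtain K where "0 < K"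
      "\<And>z w. z \<in> ball 0 1 \<Longrightarrow> w \<in> ball 0 1 \<Longrightarrow> angular_le p (osc z w) (K * \<omega> (norm (z - w)))"
      using osc_le by blast
    then show "f \<in> Lipschitz_disk \<omega> p" unfolding E1 by blast
  qed
qed

end
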